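(* Let $\Gamma$ be a compact Lie group acting linearly on a finite-dimensional real inner product space $V$, let $\sigma:\Gamma\to\mathbf{Z}_2=\{\pm1\}$ be an epimorphism, let $X:V\to V$ be a smooth $\Gamma$-reversible-equivariant vector field with $X(0)=0$, and let $L=(dX)_0$. Let $L^t$ be the adjoint of $L$, and assume that $e^{sL^t}\gamma=\gamma e^{\sigma(\gamma)sL^t}$ on $V$ for all $s\in\mathbb{R}$, $\gamma\in\Gamma$. Let $\mathbf{S}=\overline{\{e^{sL^t}: s\in\mathbb{R}\}}$. Then the system $\dot x=X(x)$ is formally conjugate to a system $$\dot x=Lx+g_2(x)+g_3(x)+\cdots$$ where, for each $k\ge 2$, $g_k\in\vec{\mathcal Q}_V^k(\mathbf{S}\rtimes\Gamma)$.
   Context: A map $g:V\to V$ is $\Gamma$-reversible-equivariant if $g(\gamma x)=\sigma(\gamma)\gamma g(x)$, and $\Gamma$-equivariant if $g(\gamma x)=\gamma g(x)$, for all $\gamma\in\Gamma$, $x\in V$. The closure defining $\mathbf{S}$ is taken in $GL(V)$. The semidirect product $\mathbf{S}\rtimes\Gamma$ is defined by $\mu:\Gamma\to\mathrm{Aut}(\mathbf{S})$ with $\mu(\gamma)(e^{sL^t})=e^{\sigma(\gamma)sL^t}$ (on all of $\mathbf S$, $\mu(\gamma)$ is conjugation by $\gamma$); it acts on $V$ by $(A,\gamma)\cdot v=A(\gamma v)$ and carries the epimorphism $\tilde\sigma(A,\gamma)=\sigma(\gamma)$. $\vec{\mathcal Q}_V^k(\mathbf{S}\rtimes\Gamma)$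 is the space of polynomial mappings $g:V\to V$, homogeneous of degree $k$, with $g(A\gamma x)=\sigma(\gamma)A\gamma g(x)$ for all $A\in\mathbf{S}$, $\gamma\in\Gamma$, $x\in V$. Formally conjugate means that the formal Taylor series at $0$ of the two systems are conjugate as formal vector fields: there is a formal change of coordinates $x=\Phi(y)$, obtained as the (formal, infinite) composition of successive changes of coordinates $I+\xi_k$, $k\ge2$, with $\xi_k$ a homogeneous polynomial mapping of degree $k$ (taken $\Gamma$-equivariant in the reversible-equivariant setting), such that $(D\Phi)_{(y)}\,Y(y)=X(\Phi(y))$ as formal power series, where $Y$ is the right-hand side of the new system. *)

theory Defs
  imports "HOL-Analysis.Analysis" "HOL-Algebra.Sym_Groups"
begin

section \<open>Smooth maps\<close>

text \<open>Class \<open>C\<^sup>k\<close> on an open set, by recursion on directional derivatives.\<close>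

primrec C_k_on :: "nat \<Rightarrow> 'a::real_normed_vector set \<Rightarrow> ('a \<Rightarrow> 'b::real_normed_vector) \<Rightarrow> bool" where
  "C_k_on 0 U f \<longleftrightarrow> continuous_on U f"
| "C_k_on (Suc k) U f \<longleftrightarrow>
     (\<forall>x\<in>U. f differentiable (at x)) \<and> (\<forall>v. C_k_on k U (\<lambda>x. frechet_derivative f (at x) v))"

definition C_infinity_on :: "'a::real_normed_vector set \<Rightarrow> ('a \<Rightarrow> 'b::real_normed_vector) \<Rightarrow> bool" where
  "C_infinity_on U f \<longleftrightarrow> open U \<and> (\<forall>k. C_k_on k U f)"

text \<open>Smoothness on an arbitrary subset: local extendability to smooth maps on open sets. If the
  subset is open in a linear subspace, this is ordinary smoothness on the subspace.\<close>

definition smooth_on :: "'a::real_normed_vector set \<Rightarrow> ('a \<Rightarrow> 'b::real_normed_vector) \<Rightarrow> bool" where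
  "smooth_on W f \<longleftrightarrow>
     (\<forall>x\<in>W. \<exists>U h. x \<in> U \<and> C_infinity_on U h \<and> (\<forall>z\<in>U \<inter> W. h z = f z))"

section \<open>Compact Lie groups and their linear actions\<close>

text \<open>Charts take values in a linear subspace \<open>E\<close> of a Euclidean space rather than in the whole
  space, since a Euclidean space type has positive dimension and \<open>E = {0}\<close> is needed for
  finite groups. A chart is a pair of its domain and its coordinate map.\<close>

definition smooth_atlas ::
  "'g topology \<Rightarrow> 'm::euclidean_space set \<Rightarrow> ('g set \<times> ('g \<Rightarrow> 'm)) set \<Rightarrow> bool" where
  "smooth_atlas T E \<A> \<longleftrightarrow>
     subspace E \<and>
     (\<Union>(U, \<phi>)\<in>\<A>. U) = topspace T \<and>
     (\<forall>(U, \<phi>)\<in>\<A>. openin T U \<and> openin (top_of_set E) (\<phi> ` U) \<and>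
        homeomorphic_map (subtopology T U) (top_of_set (\<phi> ` U)) \<phi>) \<and>
     (\<forall>(U, \<phi>)\<in>\<A>. \<forall>(V, \<psi>)\<in>\<A>. smooth_on (\<phi> ` (U \<inter> V)) (\<lambda>x. \<psi> (inv_into U \<phi> x)))"

definition lie_group ::
  "('g, 'r) monoid_scheme \<Rightarrow> 'g topology \<Rightarrow> 'm::euclidean_space set \<Rightarrow>
     ('g set \<times> ('g \<Rightarrow> 'm)) set \<Rightarrow> bool" where
  "lie_group G T E \<A> \<longleftrightarrow>
     group G \<and> topspace T = carrier G \<and> Hausdorff_space T \<and> second_countable T \<and>
     smooth_atlas T E \<A> \<and>
     continuous_map (prod_topology T T) T (\<lambda>(a, b). a \<otimes>\<^bsub>G\<^esub> b) \<and>
     continuous_map T T (\<lambda>a. inv\<^bsub>G\<^esub> a) \<and>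
     (\<forall>(U, \<phi>)\<in>\<A>. \<forall>(V, \<psi>)\<in>\<A>. \<forall>(W, \<theta>)\<in>\<A>.
        smooth_on {(x, y). x \<in> \<phi> ` U \<and> y \<in> \<psi> ` V \<and> inv_into U \<phi> x \<otimes>\<^bsub>G\<^esub> inv_into V \<psi> y \<in> W}
          (\<lambda>(x, y). \<theta> (inv_into U \<phi> x \<otimes>\<^bsub>G\<^esub> inv_into V \<psi> y))) \<and>
     (\<forall>(U, \<phi>)\<in>\<A>. \<forall>(V, \<psi>)\<in>\<A>.
        smooth_on {x. x \<in> \<phi> ` U \<and> inv\<^bsub>G\<^esub> (inv_into U \<phi> x) \<in> V}
          (\<lambda>x. \<psi> (inv\<^bsub>G\<^esub> (inv_into U \<phi> x))))"

definition compact_lie_group ::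
  "('g, 'r) monoid_scheme \<Rightarrow> 'g topology \<Rightarrow> 'm::euclidean_space set \<Rightarrow>
     ('g set \<times> ('g \<Rightarrow> 'm)) set \<Rightarrow> bool" where
  "compact_lie_group G T E \<A> \<longleftrightarrow> lie_group G T E \<A> \<and> compact_space T"

definition linear_action ::
  "('g, 'r) monoid_scheme \<Rightarrow> 'g topology \<Rightarrow> ('g \<Rightarrow> 'a::real_normed_vector \<Rightarrow>\<^sub>L 'a) \<Rightarrow> bool" where
  "linear_action G T \<rho> \<longleftrightarrow>
     \<rho> \<one>\<^bsub>G\<^esub> = id_blinfun \<and>
     (\<forall>\<gamma>\<in>carrier G. \<forall>\<delta>\<in>carrier G. \<rho> (\<gamma> \<otimes>\<^bsub>G\<^esub> \<delta>) = \<rho> \<gamma> o\<^sub>L \<rho> \<delta>) \<and>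
     continuous_map (prod_topology T euclidean) euclidean (\<lambda>(\<gamma>, v). \<rho> \<gamma> v)"

definition equivariant ::
  "('g, 'r) monoid_scheme \<Rightarrow> ('g \<Rightarrow> 'a::real_normed_vector \<Rightarrow>\<^sub>L 'a) \<Rightarrow> ('a \<Rightarrow> 'a) \<Rightarrow> bool" where
  "equivariant G \<rho> g \<longleftrightarrow> (\<forall>\<gamma>\<in>carrier G. \<forall>x. g (\<rho> \<gamma> x) = \<rho> \<gamma> (g x))"

definition reversible_equivariant ::
  "('g, 'r) monoid_scheme \<Rightarrow> ('g \<Rightarrow> 'a::real_normed_vector \<Rightarrow>\<^sub>L 'a) \<Rightarrow> ('g \<Rightarrow> int) \<Rightarrow>
     ('a \<Rightarrow> 'a) \<Rightarrow> bool" where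
  "reversible_equivariant G \<rho> \<sigma> g \<longleftrightarrow>
     (\<forall>\<gamma>\<in>carrier G. \<forall>x. g (\<rho> \<gamma> x) = of_int (\<sigma> \<gamma>) *\<^sub>R \<rho> \<gamma> (g x))"

section \<open>Homogeneous polynomial mappings\<close>

definition homogeneous_polynomial ::
  "nat \<Rightarrow> ('a::real_normed_vector \<Rightarrow> 'b::real_normed_vector) \<Rightarrow> bool" where
  "homogeneous_polynomial k g \<longleftrightarrow>
     polynomial_function g \<and> (\<forall>c x. g (c *\<^sub>R x) = c ^ k *\<^sub>R g x)"

definition reversible_equivariant_polys ::
  "nat \<Rightarrow> ('g, 'r) monoid_scheme \<Rightarrow> ('g \<Rightarrow> 'a::real_normed_vector \<Rightarrow>\<^sub>L 'a) \<Rightarrow> ('g \<Rightarrow> int) \<Rightarrow>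
     ('a \<Rightarrow> 'a) set" where
  "reversible_equivariant_polys k G \<rho> \<sigma> =
     {g. homogeneous_polynomial k g \<and> reversible_equivariant G \<rho> \<sigma> g}"

section \<open>The group \<open>S\<close> and its semidirect product with \<open>\<Gamma>\<close>\<close>

definition blinfun_adjoint :: "('a::euclidean_space \<Rightarrow>\<^sub>L 'a) \<Rightarrow> 'a \<Rightarrow>\<^sub>L 'a" where
  "blinfun_adjoint L = Blinfun (adjoint (blinfun_apply L))"

definition blinfun_exp :: "('a::real_normed_vector \<Rightarrow>\<^sub>L 'a) \<Rightarrow> 'a \<Rightarrow>\<^sub>L 'a" where
  "blinfun_exp A = (\<Sum>n. (1 / fact n) *\<^sub>R (((o\<^sub>L) A) ^^ n) id_blinfun)"

definition GL :: "('a::real_normed_vector \<Rightarrow>\<^sub>L 'a) set" where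
  "GL = {A. \<exists>B. A o\<^sub>L B = id_blinfun \<and> B o\<^sub>L A = id_blinfun}"

definition S_group :: "('a::euclidean_space \<Rightarrow>\<^sub>L 'a) \<Rightarrow> ('a \<Rightarrow>\<^sub>L 'a) monoid" where
  "S_group L =
     \<lparr>carrier = top_of_set GL closure_of range (\<lambda>s. blinfun_exp (s *\<^sub>R blinfun_adjoint L)),
      mult = (o\<^sub>L), one = id_blinfun\<rparr>"

definition semidirect_product ::
  "('n, 'q) monoid_scheme \<Rightarrow> ('g, 'r) monoid_scheme \<Rightarrow> ('g \<Rightarrow> 'n \<Rightarrow> 'n) \<Rightarrow> ('n \<times> 'g) monoid" where
  "semidirect_product N G \<mu> =
     \<lparr>carrier = carrier N \<times> carrier G,
      mult = (\<lambda>(A, \<gamma>) (B, \<delta>). (A \<otimes>\<^bsub>N\<^esub> \<mu> \<gamma> B, \<gamma> \<otimes>\<^bsub>G\<^esub> \<delta>)),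
      one = (\<one>\<^bsub>N\<^esub>, \<one>\<^bsub>G\<^esub>)\<rparr>"

text \<open>The action of \<open>\<Gamma>\<close> on \<open>S\<close>. If \<open>e\<^bsup>sM\<^esup> \<gamma> = \<gamma> e\<^bsup>\<sigma>(\<gamma>)sM\<^esup>\<close> for the adjoint \<open>M\<close> of \<open>L\<close>, it sends
  \<open>e\<^bsup>sM\<^esup>\<close> to \<open>e\<^bsup>\<sigma>(\<gamma>)sM\<^esup>\<close>.\<close>

definition conjugation ::
  "('g, 'r) monoid_scheme \<Rightarrow> ('g \<Rightarrow> 'a::real_normed_vector \<Rightarrow>\<^sub>L 'a) \<Rightarrow> 'g \<Rightarrow>
     ('a \<Rightarrow>\<^sub>L 'a) \<Rightarrow> 'a \<Rightarrow>\<^sub>L 'a" where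
  "conjugation G \<rho> \<gamma> A = \<rho> \<gamma> o\<^sub>L A o\<^sub>L \<rho> (inv\<^bsub>G\<^esub> \<gamma>)"

definition Q_space ::
  "nat \<Rightarrow> ('a::euclidean_space \<Rightarrow>\<^sub>L 'a) \<Rightarrow> ('g, 'r) monoid_scheme \<Rightarrow> ('g \<Rightarrow> 'a \<Rightarrow>\<^sub>L 'a) \<Rightarrow>
     ('g \<Rightarrow> int) \<Rightarrow> ('a \<Rightarrow> 'a) set" where
  "Q_space k L G \<rho> \<sigma> =
     reversible_equivariant_polys k
       (semidirect_product (S_group L) G (conjugation G \<rho>))
       (\<lambda>(A, \<gamma>). A o\<^sub>L \<rho> \<gamma>)
       (\<lambda>(A, \<gamma>). \<sigma> \<gamma>)"

section \<open>Formal conjugacy\<close>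

text \<open>A formal power series mapping is represented by the sequence of its homogeneous parts.
  The part of degree \<open>k\<close> of the Taylor series of \<open>f\<close> at \<open>0\<close> is \<open>x \<mapsto> D\<^sup>kf(0)(x,\<dots>,x)/k!\<close>.
  Applied to a polynomial mapping it yields the homogeneous part of degree \<open>k\<close>.\<close>

definition taylor_part :: "nat \<Rightarrow> ('a::real_normed_vector \<Rightarrow> 'b::real_normed_vector) \<Rightarrow> 'a \<Rightarrow> 'b" where
  "taylor_part k f x =
     (1 / fact k) *\<^sub>R ((\<lambda>h y. frechet_derivative h (at y) x) ^^ k) f 0"

text \<open>The composition \<open>F \<circ> \<Phi>\<close>, for series \<open>\<Phi>\<close> without constant term: its part of degree \<open>n\<close> then
  depends only on the parts of \<open>F\<close> and \<open>\<Phi>\<close> of degree at most \<open>n\<close>.\<close>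

definition formal_compose ::
  "(nat \<Rightarrow> 'a::real_normed_vector \<Rightarrow> 'a) \<Rightarrow> (nat \<Rightarrow> 'a \<Rightarrow> 'a) \<Rightarrow> nat \<Rightarrow> 'a \<Rightarrow> 'a" where
  "formal_compose F \<Phi> n = taylor_part n (\<lambda>y. \<Sum>i\<le>n. F i (\<Sum>j\<le>n. \<Phi> j y))"

text \<open>The series \<open>(D\<Phi>)\<^sub>y Y(y)\<close>: the term \<open>(D\<Phi>\<^sub>j)\<^sub>y Y\<^sub>i(y)\<close> has degree \<open>j - 1 + i\<close>, and it
  vanishes for \<open>j = 0\<close>.\<close>

definition formal_derivative_apply ::
  "(nat \<Rightarrow> 'a::real_normed_vector \<Rightarrow> 'a) \<Rightarrow> (nat \<Rightarrow> 'a \<Rightarrow> 'a) \<Rightarrow> nat \<Rightarrow> 'a \<Rightarrow> 'a" where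
  "formal_derivative_apply \<Phi> Y n y =
     (\<Sum>j = 1..Suc n. frechet_derivative (\<Phi> j) (at y) (Y (Suc n - j) y))"

text \<open>\<open>(I + \<xi>\<^sub>2) \<circ> (I + \<xi>\<^sub>3) \<circ> \<dots> \<circ> (I + \<xi>\<^sub>m\<^sub>+\<^sub>1)\<close>\<close>

primrec partial_composition ::
  "(nat \<Rightarrow> 'a::real_normed_vector \<Rightarrow> 'a) \<Rightarrow> nat \<Rightarrow> 'a \<Rightarrow> 'a" where
  "partial_composition \<xi> 0 = id"
| "partial_composition \<xi> (Suc m) = partial_composition \<xi> m \<circ> (\<lambda>y. y + \<xi> (m + 2) y)"

text \<open>The infinite composition is the limit of the finite ones in the formal sense: each homogeneous
  part is eventually constant.\<close>

definition infinite_composition ::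
  "(nat \<Rightarrow> 'a::real_normed_vector \<Rightarrow> 'a) \<Rightarrow> (nat \<Rightarrow> 'a \<Rightarrow> 'a) \<Rightarrow> bool" where
  "infinite_composition \<xi> \<Phi> \<longleftrightarrow>
     (\<forall>n. \<forall>\<^sub>F m in sequentially. taylor_part n (partial_composition \<xi> m) = \<Phi> n)"

definition formally_conjugate ::
  "('g, 'r) monoid_scheme \<Rightarrow> ('g \<Rightarrow> 'a::real_normed_vector \<Rightarrow>\<^sub>L 'a) \<Rightarrow>
     (nat \<Rightarrow> 'a \<Rightarrow> 'a) \<Rightarrow> (nat \<Rightarrow> 'a \<Rightarrow> 'a) \<Rightarrow> bool" where
  "formally_conjugate G \<rho> X Y \<longleftrightarrow>
     (\<exists>\<xi> \<Phi>. (\<forall>k\<ge>2. homogeneous_polynomial k (\<xi> k) \<and> equivariant G \<rho> (\<xi> k)) \<and>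
        infinite_composition \<xi> \<Phi> \<and>
        formal_derivative_apply \<Phi> Y = formal_compose X \<Phi>)"

end

theory Submission
  imports Defs
begin

text \<open>The degree \<open>n\<close> part of the conjugacy equation reads \<open>R\<^sub>n = (D\<Phi>\<^sub>n Lx - L\<Phi>\<^sub>n) + g\<^sub>n\<close>, where
  \<open>R\<^sub>n\<close> involves only the parts of lower degree, so \<open>\<Phi>\<^sub>n\<close> and \<open>g\<^sub>n\<close> can be chosen degree by degree.
  For the Fischer form the homological operator of \<open>L\<close> has the homological operator of \<open>L\<^sup>t\<close> as its
  adjoint. Hence \<open>R\<^sub>n\<close> splits uniquely into an image of an element of the range of the adjoint and an
  element \<open>g\<^sub>n\<close> of the kernel of the adjoint, and this kernel consists of the mappings commuting with
  \<open>e\<^bsup>sL\<^sup>t\<^esup>\<close>. Since \<open>\<gamma>\<close> commutes with \<open>L\<close> and \<open>L\<^sup>t\<close> up to the sign \<open>\<sigma>(\<gamma>)\<close>, uniqueness makes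
  \<open>\<Phi>\<^sub>n\<close> equivariant and \<open>g\<^sub>n\<close> reversible-equivariant.\<close>

section \<open>Directional derivatives\<close>

text \<open>A preimage under the homological operator of \<open>L\<close> is fixed only up to the
  kernel, so an arbitrary choice of \<Phi>_n need not respect \<Gamma>. Taking \<Phi>_n =
  \<open>homological M w\<close>, in the range of the adjoint, removes this freedom, and one
  uniqueness statement then gives the symmetry of \<Phi>_n and of g_n together. The sign rule for
  \<open>L\<close> is read off the linear part of X; the one for the adjoint comes from
  differentiating the hypothesis on the exponentials at s = 0. The equation is solved for the whole
  series \<Phi> and Y instead of transforming X one degree at a time. The factors I + \<xi>_k are
  recovered from \<Phi> afterwards and inherit its linear symmetries. Homogeneous parts are defined
  by iterated derivatives at 0, for which a higher chain rule would be unwieldy. Parts of composites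
  are identified through growth along rays instead: the value at t x is compared with a polynomial
  in t up to an error of order t^(n+1), which determines all parts of degree at most n.\<close>

definition dderiv :: "'a::real_normed_vector \<Rightarrow> ('a \<Rightarrow> 'b::real_normed_vector) \<Rightarrow> 'a \<Rightarrow> 'b" where
  "dderiv v f x = frechet_derivative f (at x) v"

lemma dderiv_eqI: "(\<And>x. (f has_derivative f' x) (at x)) \<Longrightarrow> dderiv v f = (\<lambda>x. f' x v)"
  unfolding dderiv_def using frechet_derivative_at by metis

lemma has_derivative_dderiv:
  "f differentiable (at x) \<Longrightarrow> (f has_derivative (\<lambda>v. dderiv v f x)) (at x)"
  unfolding dderiv_def using frechet_derivative_works by blast

lemma linear_dderiv: "f differentiable (at x) \<Longrightarrow> linear (\<lambda>v. dderiv v f x)"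
  using has_derivative_dderiv has_derivative_linear by blast

lemma dderiv_expand:
  fixes f :: "'a::euclidean_space \<Rightarrow> 'b::real_normed_vector"
  assumes "f differentiable (at x)"
  shows "dderiv v f x = (\<Sum>e\<in>Basis. (v \<bullet> e) *\<^sub>R dderiv e f x)"
proof -
  have "dderiv v f x = dderiv (\<Sum>e\<in>Basis. (v \<bullet> e) *\<^sub>R e) f x"
    by (simp add: euclidean_representation)
  also have "\<dots> = (\<Sum>e\<in>Basis. (v \<bullet> e) *\<^sub>R dderiv e f x)"
    by (simp add: linear_sum[OF linear_dderiv[OF assms]] linear_cmul[OF linear_dderiv[OF assms]])
  finally show ?thesis .
qed

lemma dderiv_zero: "f differentiable (at x) \<Longrightarrow> dderiv 0 f x = 0"
  using linear_dderiv linear_0 by blast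

lemma dderiv_lincomb:
  assumes "\<And>i x. i \<in> I \<Longrightarrow> f i differentiable (at x)"
  shows "dderiv v (\<lambda>x. \<Sum>i\<in>I. c i *\<^sub>R f i x) = (\<lambda>x. \<Sum>i\<in>I. c i *\<^sub>R dderiv v (f i) x)"
  by (rule dderiv_eqI) (intro derivative_intros has_derivative_dderiv assms)

lemma dderiv_scale_add:
  assumes "\<And>x. f differentiable (at x)" "\<And>x. g differentiable (at x)"
  shows "dderiv v (\<lambda>x. a *\<^sub>R f x + b *\<^sub>R g x) = (\<lambda>x. a *\<^sub>R dderiv v f x + b *\<^sub>R dderiv v g x)"
  by (rule dderiv_eqI) (intro derivative_intros has_derivative_dderiv assms)

lemma dderiv_bounded_linear:
  assumes "bounded_linear A" "\<And>x. f differentiable (at x)"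
  shows "dderiv v (\<lambda>x. A (f x)) = (\<lambda>x. A (dderiv v f x))"
  by (rule dderiv_eqI)
    (rule bounded_linear.has_derivative[OF assms(1) has_derivative_dderiv[OF assms(2)]])

lemma dderiv_compose:
  assumes "\<And>x. f differentiable (at x)" "\<And>x. g differentiable (at x)"
  shows "dderiv v (\<lambda>x. f (g x)) = (\<lambda>x. dderiv (dderiv v g x) f (g x))"
proof (rule dderiv_eqI)
  show "((\<lambda>x. f (g x)) has_derivative (\<lambda>v. dderiv (dderiv v g x) f (g x))) (at x)" for x
    using has_derivative_compose[OF has_derivative_dderiv[OF assms(2)] has_derivative_dderiv[OF assms(1)]] .
qed

lemma dderiv_linear: "bounded_linear A \<Longrightarrow> dderiv v A = (\<lambda>x. A v)"
  by (rule dderiv_eqI) (rule bounded_linear_imp_has_derivative)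

text \<open>\<open>C_k_on\<close> recurses through directional derivatives, so a class of
  differentiable functions closed under them satisfies the recursion at every order. Polynomials are
  the class it serves.\<close>

lemma smooth_coinduct:
  assumes "P f" "\<And>f x. P f \<Longrightarrow> f differentiable (at x)" "\<And>f v. P f \<Longrightarrow> P (dderiv v f)"
  shows "C_infinity_on UNIV f"
proof -
  have "P f \<Longrightarrow> C_k_on k UNIV f" for k f
  proof (induction k arbitrary: f)
    case 0
    then show ?case
      using assms(2) by (simp add: continuous_on_eq_continuous_at differentiable_imp_continuous_within)
  next
    case (Suc k)
    have "dderiv v f = (\<lambda>x. frechet_derivative f (at x) v)" for v
      by (simp add: dderiv_def fun_eq_iff)
    then show ?case
      using Suc assms(2,3) by (simp flip: \<open>\<And>v. dderiv v f = _ v\<close>)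
  qed
  then show ?thesis
    using assms(1) by (simp add: C_infinity_on_def)
qed

lemma smooth_differentiable: "C_infinity_on UNIV f \<Longrightarrow> f differentiable (at x)"
  unfolding C_infinity_on_def by (metis C_k_on.simps(2) UNIV_I)

lemma smooth_dderiv: "C_infinity_on UNIV f \<Longrightarrow> C_infinity_on UNIV (dderiv v f)"
proof -
  assume "C_infinity_on UNIV f"
  then have "C_k_on (Suc k) UNIV f" for k
    by (simp only: C_infinity_on_def)
  moreover have "dderiv v f = (\<lambda>x. frechet_derivative f (at x) v)"
    by (simp add: dderiv_def fun_eq_iff)
  ultimately show ?thesis
    by (simp add: C_infinity_on_def)
qed

section \<open>Derivatives of polynomial mappings\<close>

lemma real_polynomial_dderiv:
  "real_polynomial_function p \<Longrightarrow> real_polynomial_function (dderiv v p)"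
proof (induction rule: real_polynomial_function.induct)
  case (linear f)
  then show ?case
    by (simp add: dderiv_linear real_polynomial_function.intros(2))
next
  case (const c)
  then show ?case
    by (simp add: dderiv_def[abs_def] real_polynomial_function.intros(2))
next
  case (add f g)
  then have "dderiv v (\<lambda>x. f x + g x) = (\<lambda>x. dderiv v f x + dderiv v g x)"
    using dderiv_scale_add[of f g v 1 1] differentiable_at_real_polynomial_function by auto
  with add show ?case
    by (simp add: real_polynomial_function.intros(3))
next
  case (mult f g)
  then have "dderiv v (\<lambda>x. f x * g x) = (\<lambda>x. f x * dderiv v g x + dderiv v f x * g x)"
    by (intro dderiv_eqI has_derivative_mult has_derivative_dderiv differentiable_at_real_polynomial_function)
  with mult show ?case
    by (auto intro: real_polynomial_function.intros)
qed

lemma dderiv_inner: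
  fixes p :: "'a::euclidean_space \<Rightarrow> 'b::euclidean_space"
  assumes "polynomial_function p"
  shows "dderiv v (\<lambda>x. p x \<bullet> b) = (\<lambda>x. dderiv v p x \<bullet> b)"
  by (rule dderiv_bounded_linear) (simp_all add: assms bounded_linear_inner_left differentiable_at_polynomial_function)

lemma polynomial_dderiv:
  fixes p :: "'a::euclidean_space \<Rightarrow> 'b::euclidean_space"
  assumes "polynomial_function p"
  shows "polynomial_function (dderiv v p)"
  using assms real_polynomial_dderiv[of "\<lambda>x. p x \<bullet> _" v]
  by (simp add: polynomial_function_iff_Basis_inner dderiv_inner[OF assms])

text \<open>Polynomials are built from linear functions and constants by sums and products, so the
  symmetry of second derivatives reduces to the sum and product rules.\<close>

lemma dderiv_commute_real:
  "real_polynomial_function p \<Longrightarrow> dderiv u (dderiv v p) = dderiv v (dderiv u p)"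
proof (induction rule: real_polynomial_function.induct)
  case (linear f)
  then show ?case
    by (simp add: dderiv_linear) (simp add: dderiv_def[abs_def])
next
  case (const c)
  then show ?case
    by (simp add: dderiv_def[abs_def])
next
  case (add f g)
  have *: "dderiv w (\<lambda>x. f x + g x) = (\<lambda>x. dderiv w f x + dderiv w g x)"
    if "real_polynomial_function f" "real_polynomial_function g" for f g :: "'a \<Rightarrow> real" and w
    using dderiv_scale_add[of f g w 1 1] differentiable_at_real_polynomial_function that by auto
  show ?case
    using add by (simp add: * real_polynomial_dderiv)
next
  case (mult f g)
  have p: "dderiv w (\<lambda>x. f x * g x) = (\<lambda>x. f x * dderiv w g x + dderiv w f x * g x)"
    if "real_polynomial_function f" "real_polynomial_function g" for f g :: "'a \<Rightarrow> real" and w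
    using that by (intro dderiv_eqI has_derivative_mult has_derivative_dderiv differentiable_at_real_polynomial_function)
  have *: "dderiv w (\<lambda>x. f x + g x) = (\<lambda>x. dderiv w f x + dderiv w g x)"
    if "real_polynomial_function f" "real_polynomial_function g" for f g :: "'a \<Rightarrow> real" and w
    using dderiv_scale_add[of f g w 1 1] differentiable_at_real_polynomial_function that by auto
  show ?case
    using mult by (simp add: * p real_polynomial_dderiv real_polynomial_function.intros(4) algebra_simps)
qed

lemma dderiv_commute:
  fixes p :: "'a::euclidean_space \<Rightarrow> 'b::euclidean_space"
  assumes "polynomial_function p"
  shows "dderiv u (dderiv v p) = dderiv v (dderiv u p)"
proof (rule ext, rule euclidean_eqI)
  fix x and b :: 'b
  assume "b \<in> Basis"
  have "dderiv u (dderiv v (\<lambda>x. p x \<bullet> b)) = dderiv v (dderiv u (\<lambda>x. p x \<bullet> b))"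
    by (rule dderiv_commute_real) (use assms \<open>b \<in> Basis\<close> polynomial_function_iff_Basis_inner in blast)
  then show "dderiv u (dderiv v p) x \<bullet> b = dderiv v (dderiv u p) x \<bullet> b"
    using assms by (simp add: dderiv_inner polynomial_dderiv fun_eq_iff)
qed

lemma polynomial_smooth:
  fixes p :: "'a::euclidean_space \<Rightarrow> 'b::euclidean_space"
  assumes "polynomial_function p"
  shows "C_infinity_on UNIV p"
  by (rule smooth_coinduct[where P = polynomial_function]) (simp_all add: assms differentiable_at_polynomial_function polynomial_dderiv)

lemma polynomial_blinfun:
  fixes p :: "'a::euclidean_space \<Rightarrow> 'b::euclidean_space"
  assumes "polynomial_function p"
  shows "polynomial_function (\<lambda>x. blinfun_apply A (p x))"
  using polynomial_function_compose[OF assms polynomial_function_bounded_linear[OF blinfun.bounded_linear_right[of A]]]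
  by (simp add: o_def)

lemma polynomial_dderiv_along:
  fixes p :: "'a::euclidean_space \<Rightarrow> 'b::euclidean_space"
  assumes "polynomial_function p" "polynomial_function q"
  shows "polynomial_function (\<lambda>x. dderiv (q x) p x)"
proof -
  have "(\<lambda>x. dderiv (q x) p x) = (\<lambda>x. \<Sum>e\<in>Basis. (q x \<bullet> e) *\<^sub>R dderiv e p x)"
    using assms by (intro ext dderiv_expand differentiable_at_polynomial_function)
  moreover have "polynomial_function (\<lambda>x. q x \<bullet> e)" for e
    using assms(2) polynomial_function_inner real_polynomial_function_eq by blast
  ultimately show ?thesis
    using assms by (auto intro!: polynomial_function_sum polynomial_function_mult polynomial_dderiv)
qed

section \<open>Homogeneous polynomial mappings and the Fischer form\<close>

lemma homogeneous_imp_polynomial: "homogeneous_polynomial k p \<Longrightarrow> polynomial_function p"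
  by (simp add: homogeneous_polynomial_def)

lemma homogeneous_polynomial_zero_at_0:
  "homogeneous_polynomial k p \<Longrightarrow> 0 < k \<Longrightarrow> p 0 = 0"
  unfolding homogeneous_polynomial_def by (metis power_0_left scaleR_zero_left less_irrefl)

lemma homogeneous_polynomial_lincomb:
  assumes "\<And>i. i \<in> I \<Longrightarrow> homogeneous_polynomial k (f i)"
  shows "homogeneous_polynomial k (\<lambda>x. \<Sum>i\<in>I. c i *\<^sub>R f i x)"
proof (cases "finite I")
  case True
  with assms show ?thesis
    by (auto simp: homogeneous_polynomial_def scaleR_sum_right mult.commute
        intro!: polynomial_function_sum polynomial_function_cmul sum.cong)
qed (simp add: homogeneous_polynomial_def)

lemma homogeneous_polynomial_scale_add:
  assumes "homogeneous_polynomial k p" "homogeneous_polynomial k q"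
  shows "homogeneous_polynomial k (\<lambda>x. a *\<^sub>R p x + b *\<^sub>R q x)"
  using assms by (auto simp: homogeneous_polynomial_def algebra_simps
      intro!: polynomial_function_add polynomial_function_cmul)

lemma homogeneous_polynomial_diff:
  assumes "homogeneous_polynomial k p" "homogeneous_polynomial k q"
  shows "homogeneous_polynomial k (\<lambda>x. p x - q x)"
  using homogeneous_polynomial_scale_add[OF assms, of 1 "-1"] by simp

lemma homogeneous_polynomial_blinfun:
  fixes p :: "'a::euclidean_space \<Rightarrow> 'b::euclidean_space"
  assumes "homogeneous_polynomial k p"
  shows "homogeneous_polynomial k (\<lambda>x. blinfun_apply A (p x))"
  using assms by (simp add: homogeneous_polynomial_def polynomial_blinfun blinfun.scaleR_right)

text \<open>Differentiate p(c x) = c^k p(x) in x. The factor c stays uncancelled: the identity then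
  covers c = 0 and k = 0, and in \<open>homogeneous_polynomial_homological\<close> this factor is
  supplied by L(c x) = c L x.\<close>

lemma dderiv_homogeneous:
  fixes p :: "'a::euclidean_space \<Rightarrow> 'b::euclidean_space"
  assumes "homogeneous_polynomial k p"
  shows "c *\<^sub>R dderiv v p (c *\<^sub>R x) = c ^ k *\<^sub>R dderiv v p x"
proof -
  have p: "polynomial_function p"
    using assms by (rule homogeneous_imp_polynomial)
  have "dderiv v (\<lambda>x. p (c *\<^sub>R x)) x = dderiv (c *\<^sub>R v) p (c *\<^sub>R x)"
    using p by (simp add: dderiv_compose differentiable_at_polynomial_function dderiv_linear bounded_linear_scaleR_right)
  also have "\<dots> = c *\<^sub>R dderiv v p (c *\<^sub>R x)"
    using p by (simp add: linear_cmul[OF linear_dderiv] differentiable_at_polynomial_function)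
  also have "dderiv v (\<lambda>x. p (c *\<^sub>R x)) x = dderiv v (\<lambda>x. c ^ k *\<^sub>R p x) x"
    using assms by (simp add: homogeneous_polynomial_def)
  also have "\<dots> = c ^ k *\<^sub>R dderiv v p x"
    using p by (simp add: dderiv_bounded_linear bounded_linear_scaleR_right differentiable_at_polynomial_function)
  finally show ?thesis
    by simp
qed

lemma homogeneous_polynomial_dderiv:
  fixes p :: "'a::euclidean_space \<Rightarrow> 'b::euclidean_space"
  assumes "homogeneous_polynomial (Suc k) p"
  shows "homogeneous_polynomial k (dderiv v p)"
proof -
  have poly: "polynomial_function (dderiv v p)"
    using assms homogeneous_imp_polynomial polynomial_dderiv by blast
  have *: "dderiv v p (c *\<^sub>R x) = c ^ k *\<^sub>R dderiv v p x" if "c \<noteq> 0" for c x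
    using dderiv_homogeneous[OF assms, of c v x] that by (simp flip: scaleR_scaleR)
  have "dderiv v p (c *\<^sub>R x) = c ^ k *\<^sub>R dderiv v p x" for c x
  \<comment> \<open>Cancelling c is impossible at c = 0. There the identity follows by continuity in
    c; for k = 0 this is the case 0^0 = 1.\<close>
  proof (cases "c = 0")
    case True
    have "continuous_on UNIV (\<lambda>c. dderiv v p (c *\<^sub>R x))"
      by (intro continuous_on_compose2[OF continuous_on_polymonial_function[OF poly, of UNIV]]
          continuous_intros) simp
    then have "((\<lambda>c. dderiv v p (c *\<^sub>R x)) \<longlongrightarrow> dderiv v p (0 *\<^sub>R x)) (at 0)"
      unfolding continuous_on_def by blast
    moreover have "((\<lambda>c. c ^ k *\<^sub>R dderiv v p x) \<longlongrightarrow> 0 ^ k *\<^sub>R dderiv v p x) (at (0::real))"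
      by (intro tendsto_intros)
    then have "((\<lambda>c. dderiv v p (c *\<^sub>R x)) \<longlongrightarrow> 0 ^ k *\<^sub>R dderiv v p x) (at 0)"
      by (rule Lim_transform_eventually) (auto simp: eventually_at_filter *)
    ultimately show ?thesis
      unfolding True by (rule tendsto_unique[OF trivial_limit_at])
  qed (use * in blast)
  with poly show ?thesis
    by (simp add: homogeneous_polynomial_def)
qed

lemma homogeneous_polynomial_dderiv_along:
  fixes p :: "'a::euclidean_space \<Rightarrow> 'b::euclidean_space"
  assumes "homogeneous_polynomial (Suc k) p" "homogeneous_polynomial m q"
  shows "homogeneous_polynomial (k + m) (\<lambda>x. dderiv (q x) p x)"
proof -
  have p: "polynomial_function p" and q: "polynomial_function q"
    using assms homogeneous_imp_polynomial by blast+
  have "dderiv (q (c *\<^sub>R x)) p (c *\<^sub>R x) = c ^ (k + m) *\<^sub>R dderiv (q x) p x" for c x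
  proof -
    have "dderiv (q (c *\<^sub>R x)) p (c *\<^sub>R x) = c ^ m *\<^sub>R dderiv (q x) p (c *\<^sub>R x)"
      using assms(2) p by (simp add: homogeneous_polynomial_def linear_cmul[OF linear_dderiv] differentiable_at_polynomial_function)
    also have "\<dots> = c ^ m *\<^sub>R c ^ k *\<^sub>R dderiv (q x) p x"
      using homogeneous_polynomial_dderiv[OF assms(1)] by (simp add: homogeneous_polynomial_def)
    finally show ?thesis
      by (simp add: power_add mult.commute)
  qed
  then show ?thesis
    using p q by (simp add: homogeneous_polynomial_def polynomial_dderiv_along)
qed

section \<open>The homological operator\<close>

definition transport :: "('a::euclidean_space \<Rightarrow>\<^sub>L 'a) \<Rightarrow> ('a \<Rightarrow> 'b::euclidean_space) \<Rightarrow> 'a \<Rightarrow> 'b" where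
  "transport L p x = dderiv (L x) p x"

text \<open>Up to the sign convention this is the Lie bracket of the linear field x \<mapsto> L x
  with p.\<close>

definition homological :: "('a::euclidean_space \<Rightarrow>\<^sub>L 'a) \<Rightarrow> ('a \<Rightarrow> 'a) \<Rightarrow> 'a \<Rightarrow> 'a" where
  "homological L p x = transport L p x - L (p x)"

lemma polynomial_transport:
  assumes "polynomial_function p"
  shows "polynomial_function (transport L p)"
  unfolding transport_def[abs_def]
  by (intro polynomial_dderiv_along assms polynomial_function_bounded_linear blinfun.bounded_linear_right)

lemma homogeneous_polynomial_homological:
  assumes "homogeneous_polynomial k p"
  shows "homogeneous_polynomial k (homological L p)"
proof -
  have p: "polynomial_function p"
    using assms by (rule homogeneous_imp_polynomial)
  have "transport L p (c *\<^sub>R x) = c ^ k *\<^sub>R transport L p x" for c x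
    using p by (simp add: transport_def blinfun.scaleR_right linear_cmul[OF linear_dderiv]
        differentiable_at_polynomial_function dderiv_homogeneous[OF assms])
  then have "homogeneous_polynomial k (transport L p)"
    using p by (simp add: homogeneous_polynomial_def polynomial_transport)
  then show ?thesis
    unfolding homological_def[abs_def]
    by (intro homogeneous_polynomial_diff homogeneous_polynomial_blinfun assms)
qed

lemma homological_lincomb:
  assumes "\<And>i. i \<in> I \<Longrightarrow> polynomial_function (f i)"
  shows "homological L (\<lambda>x. \<Sum>i\<in>I. c i *\<^sub>R f i x) = (\<lambda>x. \<Sum>i\<in>I. c i *\<^sub>R homological L (f i) x)"
proof -
  have "dderiv v (\<lambda>x. \<Sum>i\<in>I. c i *\<^sub>R f i x) = (\<lambda>x. \<Sum>i\<in>I. c i *\<^sub>R dderiv v (f i) x)" for v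
    using assms by (intro dderiv_lincomb differentiable_at_polynomial_function)
  then show ?thesis
    by (simp add: homological_def transport_def fun_eq_iff blinfun.sum_right blinfun.scaleR_right
        scaleR_diff_right sum_subtractf)
qed

lemma homological_scale_add:
  assumes "polynomial_function p" "polynomial_function q"
  shows "homological L (\<lambda>x. a *\<^sub>R p x + b *\<^sub>R q x) = (\<lambda>x. a *\<^sub>R homological L p x + b *\<^sub>R homological L q x)"
proof -
  have "dderiv v (\<lambda>x. a *\<^sub>R p x + b *\<^sub>R q x) = (\<lambda>x. a *\<^sub>R dderiv v p x + b *\<^sub>R dderiv v q x)" for v
    using assms by (intro dderiv_scale_add differentiable_at_polynomial_function)
  then show ?thesis
    by (simp add: homological_def transport_def fun_eq_iff blinfun.add_right blinfun.scaleR_right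
        algebra_simps)
qed

lemma homological_zero: "homological L (\<lambda>x. 0) = (\<lambda>x. 0)"
  using homological_scale_add[of "\<lambda>x. 0" "\<lambda>x. 0" L 0 0] by simp

lemma homological_scale:
  "polynomial_function p \<Longrightarrow> homological L (\<lambda>x. a *\<^sub>R p x) = (\<lambda>x. a *\<^sub>R homological L p x)"
  using homological_scale_add[of p p L a 0] by simp

text \<open>In a basis, the derivative falls either on the coefficients of L x, which produces the
  commutator term along L v, or on the derivatives of p, where second derivatives commute. This rule
  drives the induction in \<open>fischer_transport\<close>.\<close>

lemma dderiv_transport:
  fixes p :: "'a::euclidean_space \<Rightarrow> 'b::euclidean_space"
  assumes "polynomial_function p"
  shows "dderiv v (transport L p) = (\<lambda>x. transport L (dderiv v p) x + dderiv (L v) p x)"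
proof -
  have d: "dderiv w p differentiable (at x)" "p differentiable (at x)" for w x
    using assms by (auto intro!: differentiable_at_polynomial_function polynomial_dderiv)
  have T: "transport L p = (\<lambda>x. \<Sum>e\<in>Basis. (L x \<bullet> e) *\<^sub>R dderiv e p x)"
    unfolding transport_def by (intro ext dderiv_expand d)
  have "dderiv v (transport L p) =
      (\<lambda>x. \<Sum>e\<in>Basis. (L x \<bullet> e) *\<^sub>R dderiv v (dderiv e p) x + (L v \<bullet> e) *\<^sub>R dderiv e p x)"
    unfolding T by (rule dderiv_eqI)
      (intro has_derivative_sum has_derivative_scaleR has_derivative_dderiv d has_derivative_inner_left
        bounded_linear_imp_has_derivative blinfun.bounded_linear_right)
  also have "\<dots> = (\<lambda>x. (\<Sum>e\<in>Basis. (L x \<bullet> e) *\<^sub>R dderiv e (dderiv v p) x) + (\<Sum>e\<in>Basis. (L v \<bullet> e) *\<^sub>R dderiv e p x))"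
    using dderiv_commute[OF assms] by (simp add: sum.distrib)
  also have "\<dots> = (\<lambda>x. transport L (dderiv v p) x + dderiv (L v) p x)"
    unfolding transport_def by (intro ext) (simp flip: dderiv_expand[OF d(1)] dderiv_expand[OF d(2)])
  finally show ?thesis .
qed

text \<open>Unfolded, this sums, over all k-tuples of basis directions, the inner products of the
  k-fold derivatives at 0. On homogeneous mappings of degree k it is k! times the classical Fischer
  product p(\<partial>)q, taken componentwise. The recursive form lets adjointness be proved by
  moving one derivative at a time.\<close>

primrec fischer :: "nat \<Rightarrow> ('a::euclidean_space \<Rightarrow> 'b::euclidean_space) \<Rightarrow> ('a \<Rightarrow> 'b) \<Rightarrow> real" where
  "fischer 0 p q = p 0 \<bullet> q 0"
| "fischer (Suc k) p q = (\<Sum>e\<in>Basis. fischer k (dderiv e p) (dderiv e q))"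

lemma fischer_commute: "fischer k p q = fischer k q p"
proof (induction k arbitrary: p q)
  case (Suc k)
  then show ?case
    unfolding fischer.simps by (intro sum.cong refl)
qed (simp add: inner_commute)

lemma fischer_lincomb_left:
  assumes "\<And>i. i \<in> I \<Longrightarrow> polynomial_function (f i)"
  shows "fischer k (\<lambda>x. \<Sum>i\<in>I. c i *\<^sub>R f i x) q = (\<Sum>i\<in>I. c i * fischer k (f i) q)"
  using assms
proof (induction k arbitrary: f q)
  case 0
  then show ?case
    by (simp add: inner_sum_left)
next
  case (Suc k)
  have "dderiv v (\<lambda>x. \<Sum>i\<in>I. c i *\<^sub>R f i x) = (\<lambda>x. \<Sum>i\<in>I. c i *\<^sub>R dderiv v (f i) x)" for v
    using Suc.prems by (intro dderiv_lincomb differentiable_at_polynomial_function)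
  moreover have "fischer k (\<lambda>x. \<Sum>i\<in>I. c i *\<^sub>R dderiv v (f i) x) (dderiv v q)
      = (\<Sum>i\<in>I. c i * fischer k (dderiv v (f i)) (dderiv v q))" for v
    using Suc.prems by (intro Suc.IH polynomial_dderiv)
  ultimately show ?case
    by (simp add: sum_distrib_left sum.swap[of _ Basis])
qed

lemma fischer_lincomb_right:
  assumes "\<And>i. i \<in> I \<Longrightarrow> polynomial_function (f i)"
  shows "fischer k q (\<lambda>x. \<Sum>i\<in>I. c i *\<^sub>R f i x) = (\<Sum>i\<in>I. c i * fischer k q (f i))"
  using fischer_lincomb_left[OF assms, where q = q] by (simp add: fischer_commute[of k q])

lemma fischer_zero_left: "fischer k (\<lambda>x. 0) q = 0"
  using fischer_lincomb_left[of "{}" _ k _ q] by simp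

lemma fischer_zero_right: "fischer k p (\<lambda>x. 0) = 0"
  by (subst fischer_commute) (rule fischer_zero_left)

lemma fischer_add_left:
  assumes "polynomial_function p" "polynomial_function p'"
  shows "fischer k (\<lambda>x. p x + p' x) q = fischer k p q + fischer k p' q"
  using fischer_lincomb_left[of UNIV "\<lambda>b. if b then p else p'" k "\<lambda>b. 1" q] assms
  by (simp add: UNIV_bool add.commute)

lemma fischer_diff_left:
  assumes "polynomial_function p" "polynomial_function p'"
  shows "fischer k (\<lambda>x. p x - p' x) q = fischer k p q - fischer k p' q"
  using fischer_lincomb_left[of UNIV "\<lambda>b. if b then p else p'" k "\<lambda>b. if b then 1 else -1" q] assms
  by (simp add: UNIV_bool)

lemma fischer_add_right:
  assumes "polynomial_function p" "polynomial_function p'"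
  shows "fischer k q (\<lambda>x. p x + p' x) = fischer k q p + fischer k q p'"
  using fischer_add_left[OF assms] by (simp add: fischer_commute[of k q])

lemma fischer_diff_right:
  assumes "polynomial_function p" "polynomial_function p'"
  shows "fischer k q (\<lambda>x. p x - p' x) = fischer k q p - fischer k q p'"
  using fischer_diff_left[OF assms] by (simp add: fischer_commute[of k q])

lemma fischer_nonneg: "0 \<le> fischer k p p"
  by (induction k arbitrary: p) (simp_all add: sum_nonneg)

text \<open>By induction all first derivatives vanish, so p is constant, and a homogeneous mapping
  of positive degree vanishes at 0.\<close>

lemma fischer_definite:
  fixes p :: "'a::euclidean_space \<Rightarrow> 'b::euclidean_space"
  assumes "homogeneous_polynomial k p" "fischer k p p = 0"
  shows "p = (\<lambda>x. 0)"
  using assms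
proof (induction k arbitrary: p)
  case 0
  have "p x = p 0" for x
    using 0(1) unfolding homogeneous_polynomial_def
    by (metis power_0 scaleR_one scaleR_zero_left)
  with 0(2) show ?case
    by (simp add: fun_eq_iff)
next
  case (Suc k)
  have zero: "dderiv e p = (\<lambda>x. 0)" if "e \<in> Basis" for e
    using Suc.prems that homogeneous_polynomial_dderiv[OF Suc.prems(1)]
    by (intro Suc.IH) (simp_all add: sum_nonneg_eq_0_iff fischer_nonneg)
  have d: "p differentiable (at x)" for x
    using Suc.prems(1) homogeneous_imp_polynomial differentiable_at_polynomial_function by blast
  have "dderiv v p x = 0" for v x
    by (simp add: dderiv_expand[OF d] zero)
  then have "(p has_derivative (\<lambda>v. 0)) (at x within UNIV)" for x
    using has_derivative_dderiv[OF d, of x] by simp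
  then obtain c where "\<And>x. p x = c"
    using has_derivative_zero_constant[of UNIV p] by auto
  moreover have "p 0 = 0"
    using Suc.prems(1) homogeneous_polynomial_zero_at_0 by blast
  ultimately show ?case
    by (simp add: fun_eq_iff)
qed

text \<open>Moving a basis derivative past \<open>transport\<close> leaves the induction hypothesis
  plus commutator terms along L e. Expanding L e in the basis exhibits the matrix of L; exchanging
  the two sums transposes it into the matrix of M.\<close>

lemma fischer_transport:
  assumes adj: "\<And>x y. blinfun_apply L x \<bullet> y = x \<bullet> blinfun_apply M y"
    and "polynomial_function p" "polynomial_function q"
  shows "fischer k (transport L p) q = fischer k p (transport M q)"
  using assms(2,3)
proof (induction k arbitrary: p q)
  case 0
  then show ?case
    by (simp add: transport_def dderiv_zero differentiable_at_polynomial_function)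
next
  case (Suc k)
  note poly = Suc.prems polynomial_dderiv[OF Suc.prems(1)] polynomial_dderiv[OF Suc.prems(2)]
  have adj': "blinfun_apply L e \<bullet> f = blinfun_apply M f \<bullet> e" for e f
    by (metis adj inner_commute)
  have expand: "dderiv v r = (\<lambda>x. \<Sum>e\<in>Basis. (v \<bullet> e) *\<^sub>R dderiv e r x)"
    if "polynomial_function r" for v and r :: "'a \<Rightarrow> 'b"
    using that by (intro ext dderiv_expand differentiable_at_polynomial_function)
  have "(\<Sum>e\<in>Basis. fischer k (dderiv (L e) p) (dderiv e q))
      = (\<Sum>e\<in>Basis. \<Sum>f\<in>Basis. (L e \<bullet> f) * fischer k (dderiv f p) (dderiv e q))"
    by (subst expand) (simp_all add: poly fischer_lincomb_left)
  also have "\<dots> = (\<Sum>f\<in>Basis. \<Sum>e\<in>Basis. (M f \<bullet> e) * fischer k (dderiv f p) (dderiv e q))"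
    by (subst sum.swap) (simp only: adj')
  also have "\<dots> = (\<Sum>f\<in>Basis. fischer k (dderiv f p) (dderiv (M f) q))"
    by (subst (3) expand) (simp_all add: poly fischer_lincomb_right)
  finally show ?case
    by (simp add: dderiv_transport poly fischer_add_left fischer_add_right polynomial_transport
        sum.distrib Suc.IH)
qed

lemma fischer_blinfun:
  assumes adj: "\<And>x y. blinfun_apply L x \<bullet> y = x \<bullet> blinfun_apply M y"
    and "polynomial_function p" "polynomial_function q"
  shows "fischer k (\<lambda>x. L (p x)) q = fischer k p (\<lambda>x. blinfun_apply M (q x))"
  using assms(2,3)
proof (induction k arbitrary: p q)
  case (Suc k)
  then show ?case
    by (simp add: dderiv_bounded_linear blinfun.bounded_linear_right differentiable_at_polynomial_function
        polynomial_dderiv)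
qed (simp add: adj)

lemma fischer_homological:
  assumes "\<And>x y. blinfun_apply L x \<bullet> y = x \<bullet> blinfun_apply M y"
    and "polynomial_function p" "polynomial_function q"
  shows "fischer k (homological L p) q = fischer k p (homological M q)"
  unfolding homological_def[abs_def] using assms
  by (simp add: fischer_diff_left fischer_diff_right polynomial_transport polynomial_blinfun
      fischer_transport[OF assms] fischer_blinfun[OF assms])

section \<open>Finite dimensionality of the homogeneous mappings of a fixed degree\<close>

lemma underdetermined_system:
  fixes a :: "'i \<Rightarrow> 'j \<Rightarrow> real"
  assumes "finite J" "finite I" "card J < card I"
  shows "\<exists>c. (\<exists>i\<in>I. c i \<noteq> 0) \<and> (\<forall>j\<in>J. (\<Sum>i\<in>I. c i * a i j) = 0)"
  using assms
proof (induction J arbitrary: I a rule: finite_induct)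
  case empty
  then obtain i where "i \<in> I"
    by fastforce
  then show ?case
    by (intro exI[of _ "\<lambda>_. 1"]) auto
next
  case (insert j J)
  show ?case
  proof (cases "\<exists>i\<in>I. a i j \<noteq> 0")
    case True
    then obtain m where m: "m \<in> I" "a m j \<noteq> 0"
      by blast
    \<comment> \<open>Gaussian elimination: equation j, whose coefficient at the unknown m is
      nonzero, is used to remove m from the other equations.\<close>
    define b where "b i l = a i l - a i j / a m j * a m l" for i l
    have "card J < card (I - {m})"
      using insert m by simp
    then obtain c where c: "\<exists>i\<in>I - {m}. c i \<noteq> 0" "\<forall>l\<in>J. (\<Sum>i\<in>I - {m}. c i * b i l) = 0"
      using insert.IH[of "I - {m}" b] insert.prems by auto
    \<comment> \<open>Back substitution: the value at m is the one that equation j forces.\<close>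
    define d where "d i = (if i = m then - (\<Sum>i\<in>I - {m}. c i * a i j) / a m j else c i)" for i
    have split: "(\<Sum>i\<in>I. d i * a i l) = d m * a m l + (\<Sum>i\<in>I - {m}. c i * a i l)" for l
      using m insert.prems by (subst sum.remove[of I m]) (auto simp: d_def intro!: sum.cong)
    have "(\<Sum>i\<in>I. d i * a i l) = 0" if "l \<in> J" for l
    proof -
      have "0 = (\<Sum>i\<in>I - {m}. c i * b i l)"
        using c that by simp
      also have "\<dots> = (\<Sum>i\<in>I - {m}. c i * a i l) - (\<Sum>i\<in>I - {m}. c i * a i j) / a m j * a m l"
        by (simp add: b_def right_diff_distrib sum_subtractf sum_distrib_left sum_distrib_right
            sum_divide_distrib mult.assoc)
      finally show ?thesis
        by (simp add: split) (simp add: d_def)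
    qed
    moreover have "(\<Sum>i\<in>I. d i * a i j) = 0"
      using m by (simp add: split) (simp add: d_def)
    moreover have "\<exists>i\<in>I. d i \<noteq> 0"
      using c(1) by (auto simp: d_def)
    ultimately show ?thesis
      by (intro exI[of _ d]) auto
  next
    case False
    have "card J < card I"
      using insert by simp
    then obtain c where "\<exists>i\<in>I. c i \<noteq> 0" "\<forall>l\<in>J. (\<Sum>i\<in>I. c i * a i l) = 0"
      using insert.IH[of I a] insert.prems by auto
    then show ?thesis
      using False by (intro exI[of _ c]) auto
  qed
qed

lemma fold_dderiv_lincomb:
  fixes f :: "'i \<Rightarrow> 'a::euclidean_space \<Rightarrow> 'b::euclidean_space"
  assumes "\<And>i. i \<in> I \<Longrightarrow> polynomial_function (f i)"
  shows "fold dderiv l (\<lambda>x. \<Sum>i\<in>I. c i *\<^sub>R f i x) = (\<lambda>x. \<Sum>i\<in>I. c i *\<^sub>R fold dderiv l (f i) x)"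
  using assms
proof (induction l arbitrary: f)
  case (Cons v l)
  have "dderiv v (\<lambda>x. \<Sum>i\<in>I. c i *\<^sub>R f i x) = (\<lambda>x. \<Sum>i\<in>I. c i *\<^sub>R dderiv v (f i) x)"
    using Cons.prems by (intro dderiv_lincomb differentiable_at_polynomial_function)
  then show ?case
    using Cons by (simp add: polynomial_dderiv)
qed simp

lemma fischer_zeroI:
  assumes "\<And>l. set l \<subseteq> Basis \<Longrightarrow> length l = k \<Longrightarrow> fold dderiv l p 0 = 0"
  shows "fischer k p q = 0"
  using assms
proof (induction k arbitrary: p q)
  case 0
  from 0[of "[]"] show ?case
    by simp
next
  case (Suc k)
  have "fischer k (dderiv e p) (dderiv e q) = 0" if "e \<in> Basis" for e
  proof (rule Suc.IH)
    show "fold dderiv l (dderiv e p) 0 = 0" if "set l \<subseteq> Basis" "length l = k" for l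
      using Suc.prems[of "e # l"] that \<open>e \<in> Basis\<close> by simp
  qed
  then show ?case
    by simp
qed

text \<open>By definiteness of the Fischer form, a mapping is determined by the finitely many
  coordinates of its k-fold basis derivatives at 0. One more mapping than there are coordinates
  forces a linear relation, and the number n does not depend on the mappings.\<close>

lemma homogeneous_polynomials_finite_dimensional:
  "\<exists>n::nat. \<forall>f. (\<forall>i. homogeneous_polynomial k (f i :: 'a::euclidean_space \<Rightarrow> 'b::euclidean_space)) \<longrightarrow>
     (\<exists>c. (\<exists>i<n. c i \<noteq> 0) \<and> (\<lambda>x. \<Sum>i<n. c i *\<^sub>R f i x) = (\<lambda>x. 0))"
proof -
  \<comment> \<open>An index of a coordinate: a list of k directions to differentiate along, and a
    basis vector of the target.\<close>
  define J where "J = {l. set l \<subseteq> (Basis::'a set) \<and> length l = k} \<times> (Basis::'b set)"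
  have J: "finite J"
    unfolding J_def by (intro finite_cartesian_product finite_lists_length_eq finite_Basis)
  have *: "\<exists>c. (\<exists>i<Suc (card J). c i \<noteq> 0) \<and> (\<lambda>x. \<Sum>i<Suc (card J). c i *\<^sub>R f i x) = (\<lambda>x. 0)"
    if f: "\<And>i. homogeneous_polynomial k (f i)" for f :: "nat \<Rightarrow> 'a \<Rightarrow> 'b"
  proof -
    obtain c where c: "\<exists>i\<in>{..<Suc (card J)}. c i \<noteq> 0"
      "\<forall>(l, b)\<in>J. (\<Sum>i<Suc (card J). c i * (fold dderiv l (f i) 0 \<bullet> b)) = 0"
      using underdetermined_system[OF J, of "{..<Suc (card J)}" "\<lambda>i (l, b). fold dderiv l (f i) 0 \<bullet> b"]
      by (auto simp: split_beta simp del: sum.lessThan_Suc)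
    define p where "p x = (\<Sum>i<Suc (card J). c i *\<^sub>R f i x)" for x
    have p: "homogeneous_polynomial k p"
      unfolding p_def[abs_def] by (intro homogeneous_polynomial_lincomb f)
    have "fold dderiv l p 0 = 0" if "set l \<subseteq> Basis" "length l = k" for l
    proof (rule euclidean_eqI)
      fix b :: 'b
      assume "b \<in> Basis"
      then have "(l, b) \<in> J"
        using that by (simp add: J_def)
      then show "fold dderiv l p 0 \<bullet> b = 0 \<bullet> b"
        using c(2) f[THEN homogeneous_imp_polynomial] unfolding p_def[abs_def]
        by (subst fold_dderiv_lincomb) (auto simp: inner_sum_left simp del: sum.lessThan_Suc)
    qed
    then have "p = (\<lambda>x. 0)"
      using fischer_definite[OF p] fischer_zeroI by blast
    with c(1) show ?thesis
      unfolding p_def[abs_def] by (intro exI[of _ c]) (auto simp del: sum.lessThan_Suc)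
  qed
  show ?thesis
    by (intro exI[of _ "Suc (card J)"] allI impI, rule *) blast
qed

section \<open>Splitting by the homological operator\<close>

text \<open>By adjointness the Fischer square of \<open>homological M p\<close> equals the pairing
  of \<open>homological L (homological M p)\<close> with p.\<close>

lemma homological_kernel_adjoint_comp:
  fixes L M :: "'a::euclidean_space \<Rightarrow>\<^sub>L 'a"
  assumes adj: "\<And>x y. blinfun_apply L x \<bullet> y = x \<bullet> blinfun_apply M y"
    and p: "homogeneous_polynomial k p"
    and "homological L (homological M p) = (\<lambda>x. 0)"
  shows "homological M p = (\<lambda>x. 0)"
proof (rule fischer_definite)
  show M: "homogeneous_polynomial k (homological M p)"
    using p by (rule homogeneous_polynomial_homological)
  have "fischer k (homological M p) (homological M p) = fischer k (homological L (homological M p)) p"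
    by (rule fischer_homological[symmetric])
      (use adj p M homogeneous_imp_polynomial in blast)+
  then show "fischer k (homological M p) (homological M p) = 0"
    using assms(3) by (simp add: fischer_zero_left)
qed

text \<open>N is an operator composed with its adjoint, hence self-adjoint, so the Fischer square of
  N p is the pairing of p with N (N p).\<close>

lemma homological_kernel_square:
  fixes L M :: "'a::euclidean_space \<Rightarrow>\<^sub>L 'a"
  assumes adj: "\<And>x y. blinfun_apply L x \<bullet> y = x \<bullet> blinfun_apply M y"
    and p: "homogeneous_polynomial k p"
    and N: "\<And>q. N q = homological L (homological M q)"
    and "N (N p) = (\<lambda>x. 0)"
  shows "N p = (\<lambda>x. 0)"
proof (rule fischer_definite)
  have hom: "homogeneous_polynomial k (homological A q)" if "homogeneous_polynomial k q" for A and q :: "'a \<Rightarrow> 'a"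
    using that by (rule homogeneous_polynomial_homological)
  then show Np: "homogeneous_polynomial k (N p)"
    using p by (simp add: N)
  have adj': "blinfun_apply M x \<bullet> y = x \<bullet> blinfun_apply L y" for x y
    by (metis adj inner_commute)
  have "fischer k (N p) (N p) = fischer k (homological M p) (homological M (N p))"
    unfolding N[of p] by (rule fischer_homological)
      (use adj p hom homogeneous_imp_polynomial in blast)+
  also have "\<dots> = fischer k p (N (N p))"
    unfolding N[of "N p"] by (rule fischer_homological)
      (use adj' p Np hom homogeneous_imp_polynomial in blast)+
  finally show "fischer k (N p) (N p) = 0"
    using assms(4) by (simp add: fischer_zero_right)
qed

text \<open>Instead of an orthogonal projection, which would require a Euclidean structure on a space of
  functions, the splitting is read off a linear relation between the iterates \<open>N\<^sup>ip\<close>: since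
  \<open>ker N\<^sup>2 = ker N\<close>, leading factors \<open>N\<close> can be cancelled until \<open>p\<close> itself occurs.\<close>

lemma homological_splitting:
  fixes L M :: "'a::euclidean_space \<Rightarrow>\<^sub>L 'a"
  assumes adj: "\<And>x y. blinfun_apply L x \<bullet> y = x \<bullet> blinfun_apply M y"
    and p: "homogeneous_polynomial k p"
  obtains w q where "homogeneous_polynomial k w" "homogeneous_polynomial k q"
    "homological M q = (\<lambda>x. 0)" "p = (\<lambda>x. homological L (homological M w) x + q x)"
proof -
  define N where "N q = homological L (homological M q)" for q
  have hN: "homogeneous_polynomial k (N q)" if "homogeneous_polynomial k q" for q :: "'a \<Rightarrow> 'a"
    using that by (simp add: N_def homogeneous_polynomial_homological)
  have hpow: "homogeneous_polynomial k ((N ^^ i) p)" for i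
    by (induction i) (simp_all add: p hN)
  have N_lincomb: "N (\<lambda>x. \<Sum>i\<in>I. c i *\<^sub>R f i x) = (\<lambda>x. \<Sum>i\<in>I. c i *\<^sub>R N (f i) x)"
    if "\<And>i. i \<in> I \<Longrightarrow> homogeneous_polynomial k (f i)" for I :: "nat set" and c and f :: "nat \<Rightarrow> 'a \<Rightarrow> 'a"
  proof -
    have "polynomial_function (f i)" "polynomial_function (homological M (f i))" if "i \<in> I" for i
      using that \<open>\<And>i. i \<in> I \<Longrightarrow> _\<close> homogeneous_imp_polynomial homogeneous_polynomial_homological by blast+
    then show ?thesis
      by (simp add: N_def homological_lincomb)
  qed
  have N_scale: "N (\<lambda>x. a *\<^sub>R q x) = (\<lambda>x. a *\<^sub>R N q x)" if "homogeneous_polynomial k q" for a q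
    using that by (simp add: N_def homological_scale homogeneous_imp_polynomial
        homogeneous_imp_polynomial[OF homogeneous_polynomial_homological])
  \<comment> \<open>\<open>S c n\<close> is a polynomial in N with coefficients c, applied to
    p.\<close>
  define S where "S c n x = (\<Sum>i<n. c i *\<^sub>R (N ^^ i) p x)" for c n and x :: 'a
  have hS: "homogeneous_polynomial k (S c n)" for c n
    unfolding S_def[abs_def] by (intro homogeneous_polynomial_lincomb hpow)
  have hS_scale: "homogeneous_polynomial k (\<lambda>x. a *\<^sub>R S c n x)" for a c n
    using homogeneous_polynomial_scale_add[OF hS hS, of a _ _ 0] by simp
  have S_Suc: "S c (Suc n) = (\<lambda>x. c 0 *\<^sub>R p x + N (S (\<lambda>i. c (Suc i)) n) x)" for c n
    by (simp add: S_def[abs_def] N_lincomb hpow sum.lessThan_Suc_shift del: sum.lessThan_Suc)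
  \<comment> \<open>The induction carries N (S c n) = 0 instead of S c n = 0: if c 0 = 0, then S is
    N applied to the shifted sum T, and cancelling one N from N (N T) = 0 yields only N T =
    0.\<close>
  have "\<exists>w q. homogeneous_polynomial k w \<and> homogeneous_polynomial k q \<and>
      homological M q = (\<lambda>x. 0) \<and> p = (\<lambda>x. N w x + q x)"
    if "\<exists>i<n. c i \<noteq> 0" "N (S c n) = (\<lambda>x. 0)" for c n
    using that
  proof (induction n arbitrary: c)
    case (Suc n)
    let ?T = "S (\<lambda>i. c (Suc i)) n"
    show ?case
    proof (cases "c 0 = 0")
      case True
      have "N ?T = (\<lambda>x. 0)"
        using Suc.prems(2) True by (intro homological_kernel_square[OF adj hS N_def]) (simp add: S_Suc)
      moreover have "\<exists>i<n. c (Suc i) \<noteq> 0"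
        using Suc.prems(1) True by (metis less_Suc_eq_0_disj)
      ultimately show ?thesis
        by (rule Suc.IH[rotated])
    next
      \<comment> \<open>Here c 0 p = S - N T, and N S = 0 puts S into the kernel of
        \<open>homological M\<close>. Division by c 0 gives q = S / c 0 and w = - T / c 0.\<close>
      case False
      have "homological M (S c (Suc n)) = (\<lambda>x. 0)"
        using Suc.prems(2) by (intro homological_kernel_adjoint_comp[OF adj hS]) (simp add: N_def)
      then have "homological M (\<lambda>x. (1 / c 0) *\<^sub>R S c (Suc n) x) = (\<lambda>x. 0)"
        using homogeneous_imp_polynomial[OF hS] by (simp add: homological_scale)
      moreover have "N (\<lambda>x. (- 1 / c 0) *\<^sub>R ?T x) = (\<lambda>x. (- 1 / c 0) *\<^sub>R N ?T x)"
        by (rule N_scale[OF hS])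
      then have "p = (\<lambda>x. N (\<lambda>x. (- 1 / c 0) *\<^sub>R ?T x) x + (1 / c 0) *\<^sub>R S c (Suc n) x)"
        using False by (simp add: S_Suc scaleR_add_right)
      moreover have "homogeneous_polynomial k (\<lambda>x. (1 / c 0) *\<^sub>R S c (Suc n) x)"
        "homogeneous_polynomial k (\<lambda>x. (- 1 / c 0) *\<^sub>R ?T x)"
        by (intro hS_scale)+
      ultimately show ?thesis
        by blast
    qed
  qed simp
  note split = this
  obtain n :: nat where n: "\<forall>f :: nat \<Rightarrow> 'a \<Rightarrow> 'a. (\<forall>i. homogeneous_polynomial k (f i)) \<longrightarrow>
      (\<exists>c. (\<exists>i<n. c i \<noteq> 0) \<and> (\<lambda>x. \<Sum>i<n. c i *\<^sub>R f i x) = (\<lambda>x. 0))"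
    using homogeneous_polynomials_finite_dimensional[of k] by (rule exE)
  obtain c where nc: "\<exists>i<n. c i \<noteq> 0" "S c n = (\<lambda>x. 0)"
    using n[rule_format, of "\<lambda>i. (N ^^ i) p", OF hpow] unfolding S_def[abs_def] by blast
  then have "N (S c n) = (\<lambda>x. 0)"
    by (simp add: N_def homological_zero)
  with split nc(1) obtain w q where "homogeneous_polynomial k w" "homogeneous_polynomial k q"
    "homological M q = (\<lambda>x. 0)" "p = (\<lambda>x. N w x + q x)"
    by blast
  then show ?thesis
    by (intro that) (simp_all add: N_def)
qed

text \<open>The differences satisfy \<open>homological L (homological M u)\<close> = r with r in the
  kernel of \<open>homological M\<close>; pairing with r gives r = 0, and then
  \<open>homological M u\<close> = 0. The element w itself is determined only up to that kernel,
  hence the second conclusion concerns \<open>homological M w\<close>.\<close>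

lemma homological_splitting_unique:
  fixes L M :: "'a::euclidean_space \<Rightarrow>\<^sub>L 'a"
  assumes adj: "\<And>x y. blinfun_apply L x \<bullet> y = x \<bullet> blinfun_apply M y"
    and w: "homogeneous_polynomial k w" "homogeneous_polynomial k w'"
    and q: "homogeneous_polynomial k q" "homogeneous_polynomial k q'"
    and ker: "homological M q = (\<lambda>x. 0)" "homological M q' = (\<lambda>x. 0)"
    and eq: "(\<lambda>x. homological L (homological M w) x + q x) = (\<lambda>x. homological L (homological M w') x + q' x)"
  shows "q = q'" "homological M w = homological M w'"
proof -
  define u where "u x = 1 *\<^sub>R w x + (-1) *\<^sub>R w' x" for x
  define r where "r x = 1 *\<^sub>R q' x + (-1) *\<^sub>R q x" for x
  note poly = homogeneous_imp_polynomial[OF w(1)] homogeneous_imp_polynomial[OF w(2)]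
    homogeneous_imp_polynomial[OF q(1)] homogeneous_imp_polynomial[OF q(2)]
    homogeneous_imp_polynomial[OF homogeneous_polynomial_homological]
  have u: "homogeneous_polynomial k u" and r: "homogeneous_polynomial k r"
    unfolding u_def[abs_def] r_def[abs_def] by (intro homogeneous_polynomial_scale_add w q)+
  have Mu: "homological M u = (\<lambda>x. 1 *\<^sub>R homological M w x + (-1) *\<^sub>R homological M w' x)"
    unfolding u_def[abs_def] by (intro homological_scale_add poly)
  have Mr: "homological M r = (\<lambda>x. 0)"
    unfolding r_def[abs_def] using ker by (subst homological_scale_add) (simp_all add: poly)
  have "homological L (homological M u) =
      (\<lambda>x. 1 *\<^sub>R homological L (homological M w) x + (-1) *\<^sub>R homological L (homological M w') x)"
    unfolding Mu by (rule homological_scale_add) (rule poly, rule w)+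
  then have LMu: "homological L (homological M u) = r"
    using eq by (auto simp: r_def fun_eq_iff) (metis (no_types) add_diff_cancel_left' add_diff_eq diff_diff_eq2 diff_add_eq)
  have "fischer k r r = fischer k (homological M u) (homological M r)"
    by (subst (1) LMu[symmetric], rule fischer_homological)
      (use adj u r homogeneous_polynomial_homological homogeneous_imp_polynomial in blast)+
  then have r0: "r = (\<lambda>x. 0)"
    using fischer_definite[OF r] by (simp add: Mr fischer_zero_right)
  then show "q = q'"
    by (simp add: r_def fun_eq_iff)
  have "homological M u = (\<lambda>x. 0)"
    using homological_kernel_adjoint_comp[OF adj u] LMu r0 by simp
  then show "homological M w = homological M w'"
    by (simp add: Mu fun_eq_iff)
qed

text \<open>The chain rule produces the direction A L x, which equals s L A x because s is its own
  inverse; the other term gets the same sign from B. The later use has B inverse to A.\<close>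

lemma homological_conjugate:
  assumes p: "polynomial_function p"
    and A: "\<And>x. blinfun_apply L (blinfun_apply A x) = s *\<^sub>R blinfun_apply A (L x)"
    and B: "\<And>x. blinfun_apply L (blinfun_apply B x) = s *\<^sub>R blinfun_apply B (L x)"
    and s: "s * s = 1"
  shows "homological L (\<lambda>x. B (p (A x))) = (\<lambda>x. s *\<^sub>R B (homological L p (A x)))"
proof
  fix x
  have d: "p differentiable (at x)" for x
    using p by (rule differentiable_at_polynomial_function)
  have dA: "(\<lambda>x. p (A x)) differentiable (at x)" for x
    by (intro differentiable_at_polynomial_function polynomial_function_compose[OF _ p, unfolded o_def]
        polynomial_function_bounded_linear blinfun.bounded_linear_right)
  have "dderiv v (\<lambda>x. B (p (A x))) = (\<lambda>x. B (dderiv v (\<lambda>x. p (A x)) x))" for v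
    by (rule dderiv_bounded_linear) (intro blinfun.bounded_linear_right dA)+
  moreover have "dderiv v (\<lambda>x. p (A x)) = (\<lambda>x. dderiv (A v) p (A x))" for v
    using dderiv_compose[OF d, of A v]
    by (simp add: dderiv_linear blinfun.bounded_linear_right bounded_linear_imp_differentiable)
  moreover have "A (L x) = s *\<^sub>R blinfun_apply L (A x)"
    using A[of x] s by simp
  ultimately show "homological L (\<lambda>x. B (p (A x))) x = s *\<^sub>R B (homological L p (A x))"
    by (simp add: homological_def transport_def linear_cmul[OF linear_dderiv[OF d]] blinfun.scaleR_right
        blinfun.diff_right B scaleR_diff_right)
qed

section \<open>One-parameter groups\<close>

lemma norm_blinfun_power_le:
  fixes A :: "'a::real_normed_vector \<Rightarrow>\<^sub>L 'a"
  shows "norm (((o\<^sub>L) A ^^ n) id_blinfun) \<le> norm A ^ n"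
proof (induction n)
  case (Suc n)
  have "norm (A o\<^sub>L ((o\<^sub>L) A ^^ n) id_blinfun) \<le> norm A * norm (((o\<^sub>L) A ^^ n) id_blinfun)"
    by (rule norm_blinfun_compose)
  also have "\<dots> \<le> norm A * norm A ^ n"
    using Suc by (simp add: mult_left_mono)
  finally show ?case
    by simp
qed (simp add: norm_blinfun_id_le)

lemma blinfun_power_apply:
  fixes A :: "'a::real_normed_vector \<Rightarrow>\<^sub>L 'a"
  shows "(((o\<^sub>L) A ^^ n) id_blinfun) x = (blinfun_apply A ^^ n) x"
  by (induction n) simp_all

lemma blinfun_power_Suc_right:
  fixes A :: "'a::real_normed_vector \<Rightarrow>\<^sub>L 'a"
  shows "((o\<^sub>L) A ^^ Suc n) id_blinfun = ((o\<^sub>L) A ^^ n) id_blinfun o\<^sub>L A"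
  by (rule blinfun_eqI)
    (simp only: blinfun_power_apply blinfun_apply_blinfun_compose, simp only: funpow_Suc_right o_apply)

lemma blinfun_power_scaleR:
  fixes A :: "'a::real_normed_vector \<Rightarrow>\<^sub>L 'a"
  shows "((o\<^sub>L) (s *\<^sub>R A) ^^ n) id_blinfun = s ^ n *\<^sub>R ((o\<^sub>L) A ^^ n) id_blinfun"
proof (induction n)
  case (Suc n)
  then show ?case
    by (simp only: funpow.simps o_apply)
      (simp add: bounded_bilinear.scaleR_left[OF bounded_bilinear_blinfun_compose]
        bounded_bilinear.scaleR_right[OF bounded_bilinear_blinfun_compose])
qed (simp only: funpow.simps power_0 scaleR_one id_apply)

lemma summable_blinfun_exp:
  fixes A :: "'a::euclidean_space \<Rightarrow>\<^sub>L 'a"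
  shows "summable (\<lambda>n. (1 / fact n) *\<^sub>R ((o\<^sub>L) A ^^ n) id_blinfun)"
proof (rule summable_comparison_test')
  show "summable (\<lambda>n. inverse (fact n) * norm A ^ n)"
    by (rule summable_exp)
  show "norm ((1 / fact n) *\<^sub>R ((o\<^sub>L) A ^^ n) id_blinfun) \<le> inverse (fact n) * norm A ^ n" for n
    using norm_blinfun_power_le[of n A] by (simp add: divide_simps)
qed

lemma blinfun_exp_commute:
  fixes A :: "'a::euclidean_space \<Rightarrow>\<^sub>L 'a"
  shows "blinfun_exp (s *\<^sub>R A) (A x) = A (blinfun_exp (s *\<^sub>R A) x)"
proof -
  let ?f = "\<lambda>n. (1 / fact n) *\<^sub>R ((o\<^sub>L) (s *\<^sub>R A) ^^ n) id_blinfun"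
  have "blinfun_exp (s *\<^sub>R A) o\<^sub>L A = (\<Sum>n. ?f n o\<^sub>L A)"
    unfolding blinfun_exp_def
    by (rule bounded_linear.suminf[OF bounded_bilinear.bounded_linear_left[OF bounded_bilinear_blinfun_compose] summable_blinfun_exp])
  also have "(\<lambda>n. ?f n o\<^sub>L A) = (\<lambda>n. A o\<^sub>L ?f n)"
    by (simp add: blinfun_power_scaleR bounded_bilinear.scaleR_left[OF bounded_bilinear_blinfun_compose] bounded_bilinear.scaleR_right[OF bounded_bilinear_blinfun_compose]
        flip: blinfun_power_Suc_right)
  also have "suminf (\<lambda>n. A o\<^sub>L ?f n) = A o\<^sub>L blinfun_exp (s *\<^sub>R A)"
    unfolding blinfun_exp_def
    by (rule bounded_linear.suminf[OF bounded_bilinear.bounded_linear_right[OF bounded_bilinear_blinfun_compose] summable_blinfun_exp, symmetric])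
  finally show ?thesis
    by (metis blinfun_apply_blinfun_compose)
qed

text \<open>Each matrix coefficient of the exponential is a real power series in s, so termwise
  differentiation becomes available.\<close>

lemma blinfun_exp_inner_sums:
  fixes A :: "'a::euclidean_space \<Rightarrow>\<^sub>L 'a"
  shows "(\<lambda>n. (((o\<^sub>L) A ^^ n) id_blinfun v \<bullet> b) / fact n * s ^ n) sums (blinfun_exp (s *\<^sub>R A) v \<bullet> b)"
proof -
  have "bounded_linear (\<lambda>B. blinfun_apply B v \<bullet> b)" for v b :: 'a
    by (intro bounded_linear_intros)
  from bounded_linear.sums[OF this summable_sums[OF summable_blinfun_exp[of "s *\<^sub>R A"]]]
  show ?thesis
    unfolding blinfun_exp_def[symmetric]
    by (simp add: blinfun_power_scaleR blinfun.scaleR_left mult.commute)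
qed

lemma blinfun_exp_0:
  fixes A :: "'a::euclidean_space \<Rightarrow>\<^sub>L 'a"
  shows "blinfun_exp (0 *\<^sub>R A) v = v"
proof (rule euclidean_eqI)
  fix b :: 'a
  have "(\<lambda>n. (((o\<^sub>L) A ^^ n) id_blinfun v \<bullet> b) / fact n * 0 ^ n) sums (v \<bullet> b)"
    using powser_sums_zero[of "\<lambda>n. (((o\<^sub>L) A ^^ n) id_blinfun v \<bullet> b) / fact n"] by simp
  then show "blinfun_exp (0 *\<^sub>R A) v \<bullet> b = v \<bullet> b"
    using blinfun_exp_inner_sums sums_unique2 by blast
qed

lemma has_vector_derivative_blinfun_exp:
  fixes A :: "'a::euclidean_space \<Rightarrow>\<^sub>L 'a"
  shows "((\<lambda>s. blinfun_exp (s *\<^sub>R A) v) has_vector_derivative blinfun_exp (s *\<^sub>R A) (A v)) (at s)"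
  unfolding has_vector_derivative_def
proof (subst has_derivative_componentwise_within, rule ballI)
  fix b :: 'a
  let ?c = "\<lambda>n. (((o\<^sub>L) A ^^ n) id_blinfun v \<bullet> b) / fact n"
  \<comment> \<open>The factor n + 1 from differentiation cancels into the factorial, and the extra
    power of A is moved onto v: the derived series is the original one for A v.\<close>
  have diffs: "diffs ?c n = (((o\<^sub>L) A ^^ n) id_blinfun (A v) \<bullet> b) / fact n" for n
  proof -
    have "((o\<^sub>L) A ^^ Suc n) id_blinfun v = ((o\<^sub>L) A ^^ n) id_blinfun (A v)"
      by (simp only: blinfun_power_Suc_right blinfun_apply_blinfun_compose)
    then show ?thesis
      by (simp only: diffs_def fact_Suc) (simp add: field_simps del: of_nat_Suc)
  qed
  have "((\<lambda>s. \<Sum>n. ?c n * s ^ n) has_field_derivative (\<Sum>n. diffs ?c n * s ^ n)) (at s)"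
    using blinfun_exp_inner_sums sums_summable by (intro termdiffs_strong_converges_everywhere) blast
  then have "((\<lambda>s. blinfun_exp (s *\<^sub>R A) v \<bullet> b) has_field_derivative
      blinfun_exp (s *\<^sub>R A) (A v) \<bullet> b) (at s)"
    by (simp only: diffs sums_unique[OF blinfun_exp_inner_sums, symmetric])
  then show "((\<lambda>s. blinfun_exp (s *\<^sub>R A) v \<bullet> b) has_derivative
      (\<lambda>t. t *\<^sub>R blinfun_exp (s *\<^sub>R A) (A v) \<bullet> b)) (at s)"
    by (simp add: has_field_derivative_def mult.commute[of "_ \<bullet> _"] mult_commute_abs)
qed

lemma blinfun_expand:
  fixes B :: "'a::euclidean_space \<Rightarrow>\<^sub>L 'b::real_normed_vector"
  shows "B v = (\<Sum>b\<in>Basis. (v \<bullet> b) *\<^sub>R B b)"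
  by (metis (no_types, lifting) blinfun.scaleR_right blinfun.sum_right euclidean_representation sum.cong)

text \<open>The kernel condition says Dq(y) M y = M q(y). Hence the curve t \<mapsto> e^((s-t)M)
  q(e^(tM) x) has derivative 0; its values at t = 0 and t = s are the two sides. This takes the
  place of uniqueness of solutions for linear differential equations.\<close>

lemma homological_kernel_blinfun_exp:
  assumes q: "polynomial_function q" and ker: "homological M q = (\<lambda>x. 0)"
  shows "q (blinfun_exp (s *\<^sub>R M) x) = blinfun_exp (s *\<^sub>R M) (q x)"
proof -
  let ?e = "\<lambda>s. blinfun_exp (s *\<^sub>R M)"
  define u where "u t = ?e t x" for t
  have Mq: "dderiv (M y) q y = M (q y)" for y
    using fun_cong[OF ker, of y] by (simp add: homological_def transport_def)
  have "(u has_vector_derivative M (u t)) (at t)" for t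
    using has_vector_derivative_blinfun_exp[of M x t] unfolding u_def[abs_def] blinfun_exp_commute .
  then have "((\<lambda>t. q (u t)) has_vector_derivative dderiv (M (u t)) q (u t)) (at t)" for t
    unfolding has_vector_derivative_def
    using has_derivative_compose[OF _ has_derivative_dderiv[OF differentiable_at_polynomial_function[OF q]]]
      linear_cmul[OF linear_dderiv[OF differentiable_at_polynomial_function[OF q]]] by fastforce
  then have qu: "((\<lambda>t. q (u t)) has_vector_derivative M (q (u t))) (at t)" for t
    by (simp only: Mq)
  have e: "((\<lambda>t. ?e (s - t) b) has_vector_derivative - ?e (s - t) (M b)) (at t)" for t b
  proof -
    have "((\<lambda>t. s - t) has_vector_derivative -1) (at t)"
      by (auto intro!: derivative_eq_intros simp flip: has_real_derivative_iff_has_vector_derivative)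
    from vector_diff_chain_at[OF this has_vector_derivative_blinfun_exp] show ?thesis
      by (simp add: o_def)
  qed
  \<comment> \<open>Both the operator and its argument depend on t. In coordinates of the argument,
    the product rule for a scalar times a vector function suffices.\<close>
  have "((\<lambda>t. \<Sum>b\<in>Basis. (q (u t) \<bullet> b) *\<^sub>R ?e (s - t) b) has_vector_derivative
      (\<Sum>b\<in>Basis. (q (u t) \<bullet> b) *\<^sub>R - ?e (s - t) (M b) + (M (q (u t)) \<bullet> b) *\<^sub>R ?e (s - t) b)) (at t)" for t
  proof (intro has_vector_derivative_sum has_vector_derivative_scaleR e)
    show "((\<lambda>t. q (u t) \<bullet> b) has_field_derivative M (q (u t)) \<bullet> b) (at t)" for b
      unfolding has_real_derivative_iff_has_vector_derivative
      by (rule bounded_linear.has_vector_derivative[OF bounded_linear_inner_left qu])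
  qed
  moreover have "(\<Sum>b\<in>Basis. (q (u t) \<bullet> b) *\<^sub>R ?e (s - t) b) = ?e (s - t) (q (u t))" for t
    by (rule blinfun_expand[symmetric])
  moreover have "(\<Sum>b\<in>Basis. (q (u t) \<bullet> b) *\<^sub>R - ?e (s - t) (M b) + (M (q (u t)) \<bullet> b) *\<^sub>R ?e (s - t) b) = 0" for t
    using blinfun_expand[of "?e (s - t)" "M (q (u t))"] blinfun_expand[of "?e (s - t) o\<^sub>L M" "q (u t)"]
    by (simp add: sum_subtractf)
  ultimately have zero: "((\<lambda>t. ?e (s - t) (q (u t))) has_vector_derivative 0) (at t within UNIV)" for t
    by simp
  obtain c where c: "\<And>t. t \<in> UNIV \<Longrightarrow> ?e (s - t) (q (u t)) = c"
    by (rule has_vector_derivative_zero_constant[OF convex_UNIV zero]) blast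
  have "?e (s - s) (q (u s)) = ?e (s - 0) (q (u 0))"
    unfolding c[OF UNIV_I] ..
  then show ?thesis
    by (simp add: u_def blinfun_exp_0[of M, simplified])
qed

text \<open>Differentiate the relation at s = 0, applied to x; the factor c comes from the inner
  derivative.\<close>

lemma blinfun_exp_intertwine_generator:
  fixes A R :: "'a::euclidean_space \<Rightarrow>\<^sub>L 'a"
  assumes "\<And>s. blinfun_exp (s *\<^sub>R A) o\<^sub>L R = R o\<^sub>L blinfun_exp ((c * s) *\<^sub>R A)"
  shows "A (R x) = c *\<^sub>R R (A x)"
proof -
  have "((\<lambda>s. blinfun_exp ((c * s) *\<^sub>R A) x) has_vector_derivative
      c *\<^sub>R blinfun_exp (0 *\<^sub>R A) (A x)) (at 0)"
  proof -
    have "((*) c has_vector_derivative c) (at 0)"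
      by (auto intro!: derivative_eq_intros simp flip: has_real_derivative_iff_has_vector_derivative)
    from vector_diff_chain_at[OF this has_vector_derivative_blinfun_exp] show ?thesis
      by (simp add: o_def)
  qed
  then have "((\<lambda>s. R (blinfun_exp ((c * s) *\<^sub>R A) x)) has_vector_derivative R (c *\<^sub>R A x)) (at 0)"
    unfolding blinfun_exp_0 by (rule bounded_linear.has_vector_derivative[OF blinfun.bounded_linear_right])
  moreover have "(\<lambda>s. R (blinfun_exp ((c * s) *\<^sub>R A) x)) = (\<lambda>s. blinfun_exp (s *\<^sub>R A) (R x))"
    using assms by (metis blinfun_apply_blinfun_compose)
  moreover have "((\<lambda>s. blinfun_exp (s *\<^sub>R A) (R x)) has_vector_derivative A (R x)) (at 0)"
    using has_vector_derivative_blinfun_exp[of A "R x" 0] unfolding blinfun_exp_0 .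
  ultimately have "A (R x) = R (c *\<^sub>R A x)"
    using vector_derivative_unique_at by metis
  then show ?thesis
    by (simp add: blinfun.scaleR_right)
qed

lemma blinfun_adjoint_inner:
  "blinfun_apply L x \<bullet> y = x \<bullet> blinfun_apply (blinfun_adjoint L) y"
proof -
  have L: "linear (blinfun_apply L)"
    by (rule bounded_linear.linear[OF blinfun.bounded_linear_right])
  then have "bounded_linear (adjoint (blinfun_apply L))"
    using adjoint_linear linear_conv_bounded_linear by blast
  then show ?thesis
    using adjoint_works[OF L] by (simp add: blinfun_adjoint_def bounded_linear_Blinfun_apply)
qed

text \<open>For fixed x, the operators A with q(A x) = A(q x) form a closed set that contains the
  one-parameter group.\<close>

lemma homological_kernel_S_group:
  assumes q: "polynomial_function q" and ker: "homological (blinfun_adjoint L) q = (\<lambda>x. 0)"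
    and A: "A \<in> carrier (S_group L)"
  shows "q (A x) = A (q x)"
proof -
  have "continuous_on UNIV (\<lambda>A. q (blinfun_apply A x))" "continuous_on UNIV (\<lambda>A. blinfun_apply A (q x))"
    by (intro continuous_on_compose2[OF continuous_on_polymonial_function[OF q, of UNIV]]
        continuous_intros; simp)+
  then have "closed {A. q (blinfun_apply A x) = blinfun_apply A (q x)}"
    by (rule closed_Collect_eq)
  moreover have "range (\<lambda>s. blinfun_exp (s *\<^sub>R blinfun_adjoint L)) \<subseteq> {A. q (blinfun_apply A x) = blinfun_apply A (q x)}"
    using homological_kernel_blinfun_exp[OF q ker] by auto
  ultimately have "closure (range (\<lambda>s. blinfun_exp (s *\<^sub>R blinfun_adjoint L))) \<subseteq> {A. q (blinfun_apply A x) = blinfun_apply A (q x)}"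
    by (rule closure_minimal[rotated])
  \<comment> \<open>The closure taken in \<open>GL\<close> lies inside the closure in the space of
    all operators.\<close>
  moreover have "A \<in> closure (range (\<lambda>s. blinfun_exp (s *\<^sub>R blinfun_adjoint L)))"
    using A closure_mono[of "GL \<inter> range (\<lambda>s. blinfun_exp (s *\<^sub>R blinfun_adjoint L))" "range (\<lambda>s. blinfun_exp (s *\<^sub>R blinfun_adjoint L))"]
    by (auto simp: S_group_def closure_of_subtopology)
  ultimately show ?thesis
    by blast
qed

section \<open>Taylor parts\<close>

lemma taylor_part_dderiv:
  fixes f :: "'a::real_normed_vector \<Rightarrow> 'b::real_normed_vector"
  shows "taylor_part k f x = (1 / fact k) *\<^sub>R (dderiv x ^^ k) f 0"
proof -
  have "dderiv x = (\<lambda>(h :: 'a \<Rightarrow> 'b) y. frechet_derivative h (at y) x)"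
    by (intro ext) (simp add: dderiv_def)
  then show ?thesis
    by (simp add: taylor_part_def)
qed

lemma smooth_dderiv_power: "C_infinity_on UNIV f \<Longrightarrow> C_infinity_on UNIV ((dderiv v ^^ n) f)"
  by (induction n) (simp_all add: smooth_dderiv)

lemma differentiable_dderiv_power: "C_infinity_on UNIV f \<Longrightarrow> (dderiv v ^^ n) f differentiable (at x)"
  by (intro smooth_differentiable smooth_dderiv_power)

lemma dderiv_power_lincomb:
  assumes "\<And>i. i \<in> I \<Longrightarrow> C_infinity_on UNIV (f i)"
  shows "(dderiv v ^^ n) (\<lambda>x. \<Sum>i\<in>I. c i *\<^sub>R f i x) = (\<lambda>x. \<Sum>i\<in>I. c i *\<^sub>R (dderiv v ^^ n) (f i) x)"
  by (induction n) (simp_all add: dderiv_lincomb differentiable_dderiv_power assms)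

lemma taylor_part_lincomb:
  assumes "\<And>i. i \<in> I \<Longrightarrow> C_infinity_on UNIV (f i)"
  shows "taylor_part n (\<lambda>x. \<Sum>i\<in>I. c i *\<^sub>R f i x) = (\<lambda>x. \<Sum>i\<in>I. c i *\<^sub>R taylor_part n (f i) x)"
  by (rule ext) (simp add: taylor_part_dderiv dderiv_power_lincomb assms scaleR_sum_right mult.commute)

lemma taylor_part_add:
  assumes "C_infinity_on UNIV f" "C_infinity_on UNIV g"
  shows "taylor_part n (\<lambda>x. f x + g x) = (\<lambda>x. taylor_part n f x + taylor_part n g x)"
  using taylor_part_lincomb[of UNIV "\<lambda>b. if b then f else g" n "\<lambda>b. 1"] assms
  by (simp add: UNIV_bool add.commute)

lemma dderiv_power_scale_direction:
  assumes "C_infinity_on UNIV f"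
  shows "(dderiv (c *\<^sub>R v) ^^ n) f = (\<lambda>x. c ^ n *\<^sub>R (dderiv v ^^ n) f x)"
proof (induction n)
  case (Suc n)
  have d: "(dderiv v ^^ n) f differentiable (at x)" for x
    using assms by (rule differentiable_dderiv_power)
  have "dderiv (c *\<^sub>R v) (\<lambda>x. c ^ n *\<^sub>R (dderiv v ^^ n) f x) = (\<lambda>x. c ^ n *\<^sub>R dderiv (c *\<^sub>R v) ((dderiv v ^^ n) f) x)"
    by (rule dderiv_bounded_linear) (intro bounded_linear_scaleR_right d)+
  then show ?case
    using Suc by (simp add: linear_cmul[OF linear_dderiv[OF d]] mult.commute)
qed simp

text \<open>The variable v is the direction of all n derivatives. Expanding the one applied first
  splits off a coordinate of v and leaves n derivatives of the fixed function
  \<open>dderiv e f\<close>, so the induction has to range over all smooth f.\<close>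

lemma polynomial_dderiv_power:
  fixes f :: "'a::euclidean_space \<Rightarrow> 'b::euclidean_space"
  assumes "C_infinity_on UNIV f"
  shows "polynomial_function (\<lambda>v. (dderiv v ^^ n) f y)"
  using assms
proof (induction n arbitrary: f)
  case (Suc n)
  have "(dderiv v ^^ Suc n) f y = (\<Sum>e\<in>Basis. (v \<bullet> e) *\<^sub>R (dderiv v ^^ n) (dderiv e f) y)" for v
  proof -
    have "dderiv v f = (\<lambda>x. \<Sum>e\<in>Basis. (v \<bullet> e) *\<^sub>R dderiv e f x)"
      by (intro ext dderiv_expand smooth_differentiable Suc.prems)
    then show ?thesis
      by (simp add: funpow_swap1 dderiv_power_lincomb smooth_dderiv Suc.prems)
  qed
  moreover have "polynomial_function (\<lambda>v. v \<bullet> e)" for e :: 'a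
    by (intro polynomial_function_bounded_linear bounded_linear_inner_left)
  ultimately show ?case
    by (simp only:) (intro polynomial_function_sum polynomial_function_mult Suc.IH smooth_dderiv Suc.prems finite_Basis)
qed simp

lemma homogeneous_polynomial_taylor_part:
  fixes f :: "'a::euclidean_space \<Rightarrow> 'b::euclidean_space"
  assumes "C_infinity_on UNIV f"
  shows "homogeneous_polynomial k (taylor_part k f)"
  unfolding homogeneous_polynomial_def taylor_part_dderiv[abs_def]
  by (auto simp: dderiv_power_scale_direction assms mult.commute
      intro!: polynomial_function_cmul polynomial_dderiv_power)

lemma dderiv_intertwine:
  assumes f: "\<And>x. f differentiable (at x)"
    and eq: "\<And>x. f (blinfun_apply A x) = blinfun_apply B (f x)"
  shows "dderiv (A v) f (A x) = B (dderiv v f x)"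
proof -
  have "dderiv v (\<lambda>x. f (A x)) x = dderiv (A v) f (A x)"
    using f by (simp add: dderiv_compose dderiv_linear blinfun.bounded_linear_right bounded_linear_imp_differentiable)
  moreover have "dderiv v (\<lambda>x. B (f x)) x = B (dderiv v f x)"
    using f by (simp add: dderiv_bounded_linear blinfun.bounded_linear_right)
  ultimately show ?thesis
    by (simp add: eq)
qed

text \<open>The chain rule moves the base point as well, so the induction runs at every point A y;
  evaluation at 0 is possible because A fixes 0. A and B are separate so that B can carry the sign
  \<sigma>(\<gamma>).\<close>

lemma taylor_part_intertwine:
  assumes f: "C_infinity_on UNIV f"
    and eq: "\<And>x. f (blinfun_apply A x) = blinfun_apply B (f x)"
  shows "taylor_part k f (A x) = B (taylor_part k f x)"
proof -
  have "(dderiv (A x) ^^ k) f (A y) = B ((dderiv x ^^ k) f y)" for y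
  proof (induction k arbitrary: y)
    case (Suc k)
    let ?F = "(dderiv (A x) ^^ k) f"
    have d: "?F differentiable (at y)" "(dderiv x ^^ k) f differentiable (at y)" for y
      using f by (rule differentiable_dderiv_power)+
    have "dderiv (A x) ?F (A y) = dderiv x (\<lambda>y. ?F (A y)) y"
      using d by (simp add: dderiv_compose dderiv_linear blinfun.bounded_linear_right bounded_linear_imp_differentiable)
    also have "\<dots> = B (dderiv x ((dderiv x ^^ k) f) y)"
      unfolding Suc.IH using d by (simp add: dderiv_bounded_linear blinfun.bounded_linear_right)
    finally show ?case
      by simp
  qed (simp add: eq)
  from this[of 0] show ?thesis
    by (simp add: taylor_part_dderiv blinfun.scaleR_right)
qed

section \<open>Taylor expansion along rays\<close>

lemma has_vector_derivative_along_line: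
  assumes "f differentiable (at (t *\<^sub>R x))"
  shows "((\<lambda>t. f (t *\<^sub>R x)) has_vector_derivative dderiv x f (t *\<^sub>R x)) (at t)"
proof -
  have "((\<lambda>t. t *\<^sub>R x) has_derivative (\<lambda>h. h *\<^sub>R x)) (at t)"
    by (intro derivative_intros)
  from has_derivative_compose[OF this has_derivative_dderiv[OF assms]] show ?thesis
    by (simp add: has_vector_derivative_def linear_cmul[OF linear_dderiv[OF assms]])
qed

lemma taylor_part_expansion:
  fixes f :: "'a::euclidean_space \<Rightarrow> 'b::euclidean_space"
  assumes f: "C_infinity_on UNIV f"
  obtains C where "\<And>t. 0 < t \<Longrightarrow> t \<le> 1 \<Longrightarrow>
    norm (f (t *\<^sub>R x) - (\<Sum>m\<le>n. t ^ m *\<^sub>R taylor_part m f x)) \<le> C * t ^ Suc n"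
proof -
  let ?d = "\<lambda>m t. (dderiv x ^^ m) f (t *\<^sub>R x)"
  have der: "(?d m has_vector_derivative ?d (Suc m) t) (at t)" for m t
    using has_vector_derivative_along_line[OF differentiable_dderiv_power[OF f]] by simp
  \<comment> \<open>The interval is symmetric because the intermediate point of the Maclaurin
    formula is controlled only in absolute value by t.\<close>
  have "continuous_on {-1..1} (?d (Suc n))"
    by (intro continuous_at_imp_continuous_on ballI has_vector_derivative_continuous[OF der])
  then have "bounded (?d (Suc n) ` {-1..1})"
    by (intro compact_imp_bounded compact_continuous_image compact_Icc)
  then obtain K where "\<forall>y\<in>?d (Suc n) ` {-1..1}. norm y \<le> K"
    unfolding bounded_iff by blast
  then have K: "norm (?d (Suc n) s) \<le> K" if "-1 \<le> s" "s \<le> 1" for s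
    using that by auto
  \<comment> \<open>Each coordinate has its own intermediate point and error at most K t^(n+1);
    summing the coordinates gives the factor \<open>DIM('b)\<close>.\<close>
  have "norm (f (t *\<^sub>R x) - (\<Sum>m\<le>n. t ^ m *\<^sub>R taylor_part m f x)) \<le> (real DIM('b) * K) * t ^ Suc n"
    if t: "0 < t" "t \<le> 1" for t
  proof -
    let ?r = "f (t *\<^sub>R x) - (\<Sum>m\<le>n. t ^ m *\<^sub>R taylor_part m f x)"
    have "\<bar>?r \<bullet> b\<bar> \<le> K * t ^ Suc n" if b: "b \<in> Basis" for b
    proof -
      have der_b: "((\<lambda>s. ?d m s \<bullet> b) has_field_derivative ?d (Suc m) s \<bullet> b) (at s)" for m s
        unfolding has_real_derivative_iff_has_vector_derivative
        by (rule bounded_linear.has_vector_derivative[OF bounded_linear_inner_left der])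
      obtain s where s: "\<bar>s\<bar> \<le> \<bar>t\<bar>"
        and eq: "f (t *\<^sub>R x) \<bullet> b = (\<Sum>m<Suc n. (?d m 0 \<bullet> b) / fact m * t ^ m)
          + (?d (Suc n) s \<bullet> b) / fact (Suc n) * t ^ Suc n"
        using Maclaurin_bi_le[of "\<lambda>m s. ?d m s \<bullet> b" "\<lambda>s. f (s *\<^sub>R x) \<bullet> b" "Suc n" t] der_b
        by auto
      have "(\<Sum>m<Suc n. (?d m 0 \<bullet> b) / fact m * t ^ m) = (\<Sum>m\<le>n. t ^ m *\<^sub>R taylor_part m f x) \<bullet> b"
        by (simp add: inner_sum_left taylor_part_dderiv lessThan_Suc_atMost field_simps)
      with eq have "\<bar>?r \<bullet> b\<bar> = \<bar>?d (Suc n) s \<bullet> b\<bar> / fact (Suc n) * t ^ Suc n"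
        using t by (simp only: inner_diff_left) (simp add: abs_mult)
      also have "\<dots> \<le> K / 1 * t ^ Suc n"
      proof (intro mult_right_mono frac_le)
        have "\<bar>?d (Suc n) s \<bullet> b\<bar> \<le> norm (?d (Suc n) s)"
          using b by (rule Basis_le_norm)
        also have "\<dots> \<le> K"
          using s t by (intro K) auto
        finally show "\<bar>?d (Suc n) s \<bullet> b\<bar> \<le> K" .
        then show "0 \<le> K"
          by linarith
        show "1 \<le> (fact (Suc n) :: real)"
          by (rule fact_ge_1)
      qed (use t in auto)
      finally show ?thesis
        by simp
    qed
    then have "(\<Sum>b\<in>Basis. \<bar>?r \<bullet> b\<bar>) \<le> (\<Sum>b\<in>(Basis::'b set). K * t ^ Suc n)"
      by (rule sum_mono)
    with norm_le_l1[of ?r] show ?thesis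
      by simp
  qed
  then show ?thesis
    by (rule that)
qed

text \<open>Letting t tend to 0 kills the constant coefficient; division by t then lowers the degree
  and the order of the error by one.\<close>

lemma polynomial_coeffs_zero:
  fixes a :: "nat \<Rightarrow> 'b::real_normed_vector"
  assumes "\<And>t. 0 < t \<Longrightarrow> t \<le> 1 \<Longrightarrow> norm (\<Sum>m\<le>n. t ^ m *\<^sub>R a m) \<le> C * t ^ Suc n" and "m \<le> n"
  shows "a m = 0"
  using assms
proof (induction n arbitrary: a m)
  case step: 0
  have "((\<lambda>t. C * t) \<longlongrightarrow> C * 0) (at_right 0)"
    by (intro tendsto_intros)
  moreover have "eventually (\<lambda>t. norm (a 0) \<le> C * t) (at_right 0)"
    using step(1) unfolding eventually_at_right_field by (intro exI[of _ 1]) auto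
  ultimately have "norm (a 0) \<le> C * 0"
    by (intro tendsto_lowerbound[of "\<lambda>t. C * t" _ "at_right 0"]) auto
  with step show ?case
    by simp
next
  case (Suc n)
  have shift: "(\<Sum>m\<le>Suc n. t ^ m *\<^sub>R a m) = a 0 + t *\<^sub>R (\<Sum>m\<le>n. t ^ m *\<^sub>R a (Suc m))" for t
    by (subst sum.atMost_Suc_shift) (simp add: scaleR_sum_right)
  have a0: "a 0 = 0"
  proof (rule tendsto_unique[OF trivial_limit_at_right_real])
    show "((\<lambda>t. \<Sum>m\<le>Suc n. t ^ m *\<^sub>R a m) \<longlongrightarrow> 0) (at_right (0::real))"
    proof (rule Lim_null_comparison)
      show "\<forall>\<^sub>F t in at_right 0. norm (\<Sum>m\<le>Suc n. t ^ m *\<^sub>R a m) \<le> C * t ^ Suc (Suc n)"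
        using Suc.prems(1) unfolding eventually_at_right_field by (intro exI[of _ 1]) auto
      have "((\<lambda>t. C * t ^ Suc (Suc n)) \<longlongrightarrow> C * 0 ^ Suc (Suc n)) (at_right 0)"
        by (intro tendsto_intros)
      then show "((\<lambda>t. C * t ^ Suc (Suc n)) \<longlongrightarrow> 0) (at_right 0)"
        by simp
    qed
    have "((\<lambda>t. a 0 + t *\<^sub>R (\<Sum>m\<le>n. t ^ m *\<^sub>R a (Suc m))) \<longlongrightarrow>
        a 0 + 0 *\<^sub>R (\<Sum>m\<le>n. 0 ^ m *\<^sub>R a (Suc m))) (at_right (0::real))"
      by (intro tendsto_intros)
    then show "((\<lambda>t. \<Sum>m\<le>Suc n. t ^ m *\<^sub>R a m) \<longlongrightarrow> a 0) (at_right (0::real))"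
      unfolding shift by simp
  qed
  have "norm (\<Sum>m\<le>n. t ^ m *\<^sub>R a (Suc m)) \<le> C * t ^ Suc n" if "0 < t" "t \<le> 1" for t
    using Suc.prems(1)[OF that] that unfolding shift a0 by simp
  then have "a (Suc m) = 0" if "m \<le> n" for m
    using Suc.IH[of "\<lambda>m. a (Suc m)"] that by blast
  with a0 Suc.prems(2) show ?case
    by (cases m) auto
qed

text \<open>Two expansions in t with errors of order t^(n+1) have equal coefficients. Taylor parts
  can thus be read off estimates on the single ray through x.\<close>

lemma taylor_part_unique:
  fixes f :: "'a::euclidean_space \<Rightarrow> 'b::euclidean_space"
  assumes f: "C_infinity_on UNIV f"
    and c: "\<And>t. 0 < t \<Longrightarrow> t \<le> 1 \<Longrightarrow> norm (f (t *\<^sub>R x) - (\<Sum>m\<le>n. t ^ m *\<^sub>R c m)) \<le> C * t ^ Suc n"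
    and m: "m \<le> n"
  shows "taylor_part m f x = c m"
proof -
  obtain C' where C': "\<And>t. 0 < t \<Longrightarrow> t \<le> 1 \<Longrightarrow>
      norm (f (t *\<^sub>R x) - (\<Sum>m\<le>n. t ^ m *\<^sub>R taylor_part m f x)) \<le> C' * t ^ Suc n"
    using taylor_part_expansion[OF f] by blast
  have "norm (\<Sum>m\<le>n. t ^ m *\<^sub>R (taylor_part m f x - c m)) \<le> (C + C') * t ^ Suc n" if "0 < t" "t \<le> 1" for t
  proof -
    have "(\<Sum>m\<le>n. t ^ m *\<^sub>R (taylor_part m f x - c m)) =
        (f (t *\<^sub>R x) - (\<Sum>m\<le>n. t ^ m *\<^sub>R c m)) - (f (t *\<^sub>R x) - (\<Sum>m\<le>n. t ^ m *\<^sub>R taylor_part m f x))"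
      by (simp add: scaleR_diff_right sum_subtractf)
    also have "norm \<dots> \<le> C * t ^ Suc n + C' * t ^ Suc n"
      using norm_triangle_ineq4 c[OF that] C'[OF that] add_mono order_trans by blast
    finally show ?thesis
      by (simp add: distrib_right)
  qed
  from polynomial_coeffs_zero[OF this m] show ?thesis
    by simp
qed

lemma taylor_part_cong_order:
  fixes f g :: "'a::euclidean_space \<Rightarrow> 'b::euclidean_space"
  assumes f: "C_infinity_on UNIV f" and g: "C_infinity_on UNIV g"
    and C: "\<And>t. 0 < t \<Longrightarrow> t \<le> 1 \<Longrightarrow> norm (f (t *\<^sub>R x) - g (t *\<^sub>R x)) \<le> C * t ^ Suc n"
    and m: "m \<le> n"
  shows "taylor_part m f x = taylor_part m g x"
proof -
  obtain C' where C': "\<And>t. 0 < t \<Longrightarrow> t \<le> 1 \<Longrightarrow>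
      norm (g (t *\<^sub>R x) - (\<Sum>m\<le>n. t ^ m *\<^sub>R taylor_part m g x)) \<le> C' * t ^ Suc n"
    using taylor_part_expansion[OF g] by blast
  have "norm (f (t *\<^sub>R x) - (\<Sum>m\<le>n. t ^ m *\<^sub>R taylor_part m g x)) \<le> (C + C') * t ^ Suc n"
    if "0 < t" "t \<le> 1" for t
  proof -
    have "f (t *\<^sub>R x) - (\<Sum>m\<le>n. t ^ m *\<^sub>R taylor_part m g x) =
        (f (t *\<^sub>R x) - g (t *\<^sub>R x)) + (g (t *\<^sub>R x) - (\<Sum>m\<le>n. t ^ m *\<^sub>R taylor_part m g x))"
      by simp
    also have "norm \<dots> \<le> C * t ^ Suc n + C' * t ^ Suc n"
      using norm_triangle_ineq C[OF that] C'[OF that] add_mono order_trans by blast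
    finally show ?thesis
      by (simp add: distrib_right)
  qed
  from taylor_part_unique[OF f this m] show ?thesis .
qed

lemma taylor_part_homogeneous:
  fixes q :: "'a::euclidean_space \<Rightarrow> 'b::euclidean_space"
  assumes q: "homogeneous_polynomial k q"
  shows "taylor_part m q x = (if m = k then q x else 0)"
\<comment> \<open>The expansion q(t x) = t^k q(x) is exact, hence C = 0; the order must reach both
  the degree k and the queried degree m.\<close>
proof (rule taylor_part_unique[where n = "max m k" and C = 0])
  show "C_infinity_on UNIV q"
    using q homogeneous_imp_polynomial polynomial_smooth by blast
  show "norm (q (t *\<^sub>R x) - (\<Sum>m\<le>max m k. t ^ m *\<^sub>R (if m = k then q x else 0))) \<le> 0 * t ^ Suc (max m k)" for t
    using q by (simp add: homogeneous_polynomial_def if_distrib[of "(*\<^sub>R) _"] sum.delta cong: if_cong)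
qed simp

lemma polynomial_lipschitz:
  fixes F :: "'a::euclidean_space \<Rightarrow> 'b::euclidean_space"
  assumes F: "polynomial_function F"
  obtains K where "0 \<le> K" "\<And>x y. norm x \<le> R \<Longrightarrow> norm y \<le> R \<Longrightarrow> norm (F x - F y) \<le> K * norm (x - y)"
proof -
  have d: "F differentiable (at x)" for x
    using F by (rule differentiable_at_polynomial_function)
  have "\<exists>k. \<forall>x\<in>cball 0 R. norm (dderiv e F x) \<le> k" for e
  proof -
    have "compact (dderiv e F ` cball 0 R)"
      by (intro compact_continuous_image continuous_on_polymonial_function polynomial_dderiv F compact_cball)
    then show ?thesis
      by (auto dest!: compact_imp_bounded simp: bounded_iff)
  qed
  then obtain k where k: "\<And>e x. norm x \<le> R \<Longrightarrow> norm (dderiv e F x) \<le> k e"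
    by (metis mem_cball_0)
  \<comment> \<open>For negative R the ball is empty and the bounds k e may be negative; absolute
    values keep K nonnegative.\<close>
  define K where "K = (\<Sum>e\<in>Basis. \<bar>k e\<bar>)"
  have on: "onorm (\<lambda>v. dderiv v F x) \<le> K" if x: "norm x \<le> R" for x
  proof (rule onorm_le)
    fix v
    have "norm (dderiv v F x) \<le> (\<Sum>e\<in>Basis. norm ((v \<bullet> e) *\<^sub>R dderiv e F x))"
      unfolding dderiv_expand[OF d, of v] by (rule norm_sum)
    also have "\<dots> \<le> (\<Sum>e\<in>Basis. \<bar>k e\<bar> * norm v)"
    proof (rule sum_mono)
      fix e :: 'a
      assume "e \<in> Basis"
      then have "\<bar>v \<bullet> e\<bar> \<le> norm v"
        by (rule Basis_le_norm)
      moreover have "norm (dderiv e F x) \<le> \<bar>k e\<bar>"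
        using k[OF x, of e] by linarith
      ultimately show "norm ((v \<bullet> e) *\<^sub>R dderiv e F x) \<le> \<bar>k e\<bar> * norm v"
        by (simp add: mult.commute mult_mono)
    qed
    finally show "norm (dderiv v F x) \<le> K * norm v"
      by (simp add: K_def sum_distrib_right)
  qed
  have "norm (F x - F y) \<le> K * norm (x - y)" if "norm x \<le> R" "norm y \<le> R" for x y
    by (rule differentiable_bound[OF convex_cball[of 0 R], where f' = "\<lambda>x v. dderiv v F x"])
      (use that on in \<open>auto intro: has_derivative_at_withinI has_derivative_dderiv d\<close>)
  moreover have "0 \<le> K"
    by (simp add: K_def sum_nonneg)
  ultimately show ?thesis
    using that by blast
qed

text \<open>The linear term is taken at 0, not at u. The segment from u to u + v stays in the ball
  of radius |u| + |v|, where the derivative differs from the one at 0 by at most a multiple of that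
  radius.\<close>

lemma polynomial_linearization_bound:
  fixes F :: "'a::euclidean_space \<Rightarrow> 'b::euclidean_space"
  assumes F: "polynomial_function F"
  obtains K where "0 \<le> K" "\<And>u v. norm u + norm v \<le> R \<Longrightarrow>
    norm (F (u + v) - F u - dderiv v F 0) \<le> K * (norm u + norm v) * norm v"
proof -
  have d: "F differentiable (at x)" for x
    using F by (rule differentiable_at_polynomial_function)
  have "\<exists>k. 0 \<le> k \<and> (\<forall>x. norm x \<le> R \<longrightarrow> norm (dderiv e F x - dderiv e F 0) \<le> k * norm x)" for e
  proof -
    obtain k where "0 \<le> k" "\<And>x y. norm x \<le> R \<Longrightarrow> norm y \<le> R \<Longrightarrow> norm (dderiv e F x - dderiv e F y) \<le> k * norm (x - y)"
      using polynomial_lipschitz[OF polynomial_dderiv[OF F]] by blast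
    then have "norm (dderiv e F x - dderiv e F 0) \<le> k * norm x" if "norm x \<le> R" for x
      using that order_trans[OF norm_ge_zero that] by (metis diff_zero norm_zero)
    with \<open>0 \<le> k\<close> show ?thesis
      by blast
  qed
  then obtain k where k: "\<And>e. 0 \<le> k e" "\<And>e x. norm x \<le> R \<Longrightarrow> norm (dderiv e F x - dderiv e F 0) \<le> k e * norm x"
    by metis
  define K where "K = (\<Sum>e\<in>Basis. k e)"
  have K: "0 \<le> K"
    unfolding K_def by (intro sum_nonneg k)
  \<comment> \<open>The radius r is kept apart from R because the estimate is applied on the smaller
    ball of radius |u| + |v| and must scale with it.\<close>
  have on: "onorm ((\<lambda>v. dderiv v F x) - (\<lambda>v. dderiv v F 0)) \<le> K * r" if x: "norm x \<le> r" "r \<le> R" for x r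
  proof (rule onorm_le)
    fix v
    have "dderiv v F x - dderiv v F 0 = (\<Sum>e\<in>Basis. (v \<bullet> e) *\<^sub>R (dderiv e F x - dderiv e F 0))"
      unfolding dderiv_expand[OF d, of v] by (simp add: scaleR_diff_right sum_subtractf)
    then have "norm (dderiv v F x - dderiv v F 0) \<le> (\<Sum>e\<in>Basis. norm ((v \<bullet> e) *\<^sub>R (dderiv e F x - dderiv e F 0)))"
      by (simp only: norm_sum)
    also have "\<dots> \<le> (\<Sum>e\<in>Basis. k e * r * norm v)"
    proof (rule sum_mono)
      fix e :: 'a
      assume "e \<in> Basis"
      then have "\<bar>v \<bullet> e\<bar> \<le> norm v"
        by (rule Basis_le_norm)
      moreover have "norm (dderiv e F x - dderiv e F 0) \<le> k e * r"
        using k(2)[of x e] x k(1)[of e] by (meson mult_left_mono order_trans)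
      ultimately have "\<bar>v \<bullet> e\<bar> * norm (dderiv e F x - dderiv e F 0) \<le> norm v * (k e * r)"
        by (intro mult_mono) auto
      then show "norm ((v \<bullet> e) *\<^sub>R (dderiv e F x - dderiv e F 0)) \<le> k e * r * norm v"
        by (simp add: mult.commute)
    qed
    finally show "norm (((\<lambda>v. dderiv v F x) - (\<lambda>v. dderiv v F 0)) v) \<le> K * r * norm v"
      by (simp add: K_def sum_distrib_right)
  qed
  have "norm (F (u + v) - F u - dderiv v F 0) \<le> K * (norm u + norm v) * norm v"
    if uv: "norm u + norm v \<le> R" for u v
  proof -
    let ?r = "norm u + norm v"
    have "norm (F (u + v) - F u - dderiv ((u + v) - u) F 0) \<le> norm ((u + v) - u) * (K * ?r)"
    proof (rule differentiable_bound_linearization[where S = "cball 0 ?r" and f' = "\<lambda>x v. dderiv v F x"])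
      show "u + t *\<^sub>R (u + v - u) \<in> cball 0 ?r" if "t \<in> {0..1}" for t
      proof -
        have "norm (u + t *\<^sub>R v) \<le> norm u + t * norm v"
          using norm_triangle_ineq[of u "t *\<^sub>R v"] that by simp
        also have "\<dots> \<le> norm u + 1 * norm v"
          using that by (intro add_left_mono mult_right_mono) auto
        finally show ?thesis
          by simp
      qed
      show "onorm ((\<lambda>v. dderiv v F x) - (\<lambda>v. dderiv v F 0)) \<le> K * ?r" if "x \<in> cball 0 ?r" for x
        using that uv by (intro on) auto
    qed (auto intro: has_derivative_at_withinI has_derivative_dderiv d)
    then show ?thesis
      by (simp add: mult.commute)
  qed
  with K show ?thesis
    using that by blast
qed

text \<open>Along a ray p is of order t and q of order t^k. By the linearization bound, replacing
  F(p + q) by F(p) + DF(0) q costs an error of order t^(k+1), invisible in degrees up to k.\<close>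

lemma taylor_part_compose_add:
  fixes F :: "'b::euclidean_space \<Rightarrow> 'c::euclidean_space" and p q :: "'a::euclidean_space \<Rightarrow> 'b"
  assumes F: "polynomial_function F" and p: "polynomial_function p" "p 0 = 0"
    and q: "homogeneous_polynomial k q" and "1 \<le> k" "n \<le> k"
  shows "taylor_part n (\<lambda>y. F (p y + q y)) x =
    taylor_part n (\<lambda>y. F (p y)) x + (if n = k then dderiv (q x) F 0 else 0)"
proof -
  define h where "h y = dderiv (q y) F 0" for y
  have d: "F differentiable (at x)" for x
    using F by (rule differentiable_at_polynomial_function)
  note qp = homogeneous_imp_polynomial[OF q]
  have Fp: "polynomial_function (\<lambda>y. F (p y))" and Fpq: "polynomial_function (\<lambda>y. F (p y + q y))"
    using polynomial_function_compose[OF p(1) F]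
      polynomial_function_compose[OF polynomial_function_add[OF p(1) qp] F] by (simp_all add: o_def)
  have "polynomial_function h"
    using polynomial_function_compose[OF qp polynomial_function_bounded_linear[OF has_derivative_bounded_linear[OF has_derivative_dderiv[OF d, of 0]]]]
    by (simp add: o_def h_def[abs_def])
  then have h: "homogeneous_polynomial k h"
    using q linear_cmul[OF linear_dderiv[OF d]] by (simp add: homogeneous_polynomial_def h_def)
  obtain Kp where Kp: "0 \<le> Kp" "\<And>y z. norm y \<le> norm x \<Longrightarrow> norm z \<le> norm x \<Longrightarrow> norm (p y - p z) \<le> Kp * norm (y - z)"
    using polynomial_lipschitz[OF p(1)] by blast
  \<comment> \<open>Chosen so that |p(t x)| + |q(t x)| is at most t R for t in (0, 1]; the Lipschitz
    constant of p enters through p 0 = 0.\<close>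
  define R where "R = Kp * norm x + norm (q x)"
  obtain K where K: "0 \<le> K" "\<And>u v. norm u + norm v \<le> R \<Longrightarrow>
      norm (F (u + v) - F u - dderiv v F 0) \<le> K * (norm u + norm v) * norm v"
    using polynomial_linearization_bound[OF F] by blast
  have "taylor_part n (\<lambda>y. F (p y + q y)) x = taylor_part n (\<lambda>y. F (p y) + h y) x"
  proof (rule taylor_part_cong_order[where n = k and C = "K * R * norm (q x)"])
    fix t :: real
    assume t: "0 < t" "t \<le> 1"
    let ?u = "p (t *\<^sub>R x)" and ?v = "q (t *\<^sub>R x)"
    have u: "norm ?u \<le> t * (Kp * norm x)"
      using Kp(2)[of "t *\<^sub>R x" 0] t p(2) by (simp add: mult_left_le_one_le mult.left_commute)
    have v: "norm ?v = t ^ k * norm (q x)"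
      using q t by (simp add: homogeneous_polynomial_def)
    have "t ^ k \<le> t ^ 1"
      using t \<open>1 \<le> k\<close> by (intro power_decreasing) auto
    then have "norm ?v \<le> t * norm (q x)"
      unfolding v by (intro mult_right_mono) auto
    with u have uv: "norm ?u + norm ?v \<le> t * R"
      by (simp add: R_def distrib_left)
    also have "\<dots> \<le> 1 * R"
      using t Kp(1) by (intro mult_right_mono) (auto simp: R_def)
    finally have "norm (F (?u + ?v) - F ?u - dderiv ?v F 0) \<le> K * (norm ?u + norm ?v) * norm ?v"
      by (intro K) simp
    also have "\<dots> \<le> K * (t * R) * norm ?v"
      using uv K(1) by (intro mult_right_mono mult_left_mono) auto
    finally show "norm (F (p (t *\<^sub>R x) + q (t *\<^sub>R x)) - (F (p (t *\<^sub>R x)) + h (t *\<^sub>R x))) \<le> K * R * norm (q x) * t ^ Suc k"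
      by (simp add: v h_def algebra_simps)
  qed (use Fp Fpq h \<open>n \<le> k\<close> homogeneous_imp_polynomial polynomial_smooth in \<open>auto intro!: polynomial_function_add\<close>)
  also have "\<dots> = taylor_part n (\<lambda>y. F (p y)) x + taylor_part n h x"
    using Fp h homogeneous_imp_polynomial polynomial_smooth by (subst taylor_part_add) auto
  finally show ?thesis
    by (simp add: taylor_part_homogeneous[OF h] h_def)
qed

section \<open>Symmetries and infinite compositions\<close>

text \<open>Conjugating a splitting of p by A, with suitable signs, gives another splitting of p,
  and the two must coincide. The sign of p passes to q, while \<open>homological M w\<close> carries
  none.\<close>

lemma homological_splitting_symmetry:
  fixes A B L M :: "'a::euclidean_space \<Rightarrow>\<^sub>L 'a"
  assumes adj: "\<And>x y. blinfun_apply L x \<bullet> y = x \<bullet> blinfun_apply M y"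
    and w: "homogeneous_polynomial k w" and q: "homogeneous_polynomial k q"
    and ker: "homological M q = (\<lambda>x. 0)"
    and p: "p = (\<lambda>x. homological L (homological M w) x + q x)"
    and inv: "\<And>x. A (blinfun_apply B x) = x" "\<And>x. B (blinfun_apply A x) = x"
    and LA: "\<And>x. L (blinfun_apply A x) = s *\<^sub>R A (L x)"
    and MA: "\<And>x. M (blinfun_apply A x) = s *\<^sub>R A (M x)"
    and s: "s * s = 1"
    and pA: "\<And>x. p (A x) = s *\<^sub>R A (p x)"
  shows "q (A x) = s *\<^sub>R A (q x)" "homological M w (A x) = A (homological M w x)"
proof -
  define C where "C u x = B (u (blinfun_apply A x))" for u :: "'a \<Rightarrow> 'a" and x
  \<comment> \<open>The sign in w' cancels the one from \<open>homological M\<close>, so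
    \<open>homological M w'\<close> is the plain conjugate; \<open>homological L\<close> then
    contributes the single sign that p carries.\<close>
  define w' where "w' x = s *\<^sub>R C w x" for x
  define q' where "q' x = s *\<^sub>R C q x" for x
  have conj: "homological K (C u) = (\<lambda>x. s *\<^sub>R C (homological K u) x)"
    if KA: "\<And>x. blinfun_apply K (A x) = s *\<^sub>R A (K x)" and u: "homogeneous_polynomial k u" for K u
  proof -
    have "K (B x) = s *\<^sub>R B (K x)" for x
      using arg_cong[OF KA[of "B x"], of "\<lambda>y. s *\<^sub>R B y"] s by (simp add: inv blinfun.scaleR_right)
    with KA s u show ?thesis
      unfolding C_def[abs_def] by (intro homological_conjugate homogeneous_imp_polynomial)
  qed
  have hC: "homogeneous_polynomial k (C u)" if "homogeneous_polynomial k u" for u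
    using that polynomial_blinfun[of "\<lambda>x. u (A x)" B]
      polynomial_function_compose[OF polynomial_function_bounded_linear[OF blinfun.bounded_linear_right[of A]], of u]
    by (simp add: homogeneous_polynomial_def C_def[abs_def] blinfun.scaleR_right o_def)
  have hw': "homogeneous_polynomial k w'" and hq': "homogeneous_polynomial k q'"
    using homogeneous_polynomial_scale_add[OF hC[OF w] hC[OF w], of s 0]
      homogeneous_polynomial_scale_add[OF hC[OF q] hC[OF q], of s 0]
    by (simp_all add: w'_def[abs_def] q'_def[abs_def])
  have "homological M w' = (\<lambda>x. s *\<^sub>R homological M (C w) x)"
    unfolding w'_def[abs_def] by (intro homological_scale homogeneous_imp_polynomial[OF hC[OF w]])
  then have Mw': "homological M w' = C (homological M w)"
    using s by (simp add: conj[OF MA w])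
  have "homological M q' = (\<lambda>x. s *\<^sub>R homological M (C q) x)"
    unfolding q'_def[abs_def] by (intro homological_scale homogeneous_imp_polynomial[OF hC[OF q]])
  then have ker': "homological M q' = (\<lambda>x. 0)"
    using s by (simp add: conj[OF MA q] ker) (simp add: C_def)
  have LMw': "homological L (homological M w') = (\<lambda>x. s *\<^sub>R C (homological L (homological M w)) x)"
    unfolding Mw' by (intro conj LA homogeneous_polynomial_homological w)
  have "homological L (homological M w) x + q x = homological L (homological M w') x + q' x" for x
  proof -
    have "p x = s *\<^sub>R B (p (A x))"
      using s by (simp add: pA inv blinfun.scaleR_right)
    then show ?thesis
      by (simp add: p LMw' q'_def C_def blinfun.add_right scaleR_add_right)
  qed
  then have eq: "(\<lambda>x. homological L (homological M w) x + q x) = (\<lambda>x. homological L (homological M w') x + q' x)"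
    by (rule ext)
  note unique = homological_splitting_unique[OF adj w hw' q hq' ker ker' eq]
  show "q (A x) = s *\<^sub>R A (q x)"
    using s by (subst (2) unique(1)) (simp add: q'_def C_def inv blinfun.scaleR_right)
  show "homological M w (A x) = A (homological M w x)"
    by (subst (2) unique(2)) (simp add: Mw' C_def inv)
qed

text \<open>An element of the semidirect product acts by \<gamma> followed by A. The kernel
  condition handles A, reversible equivariance handles \<gamma>, and the sign depends on \<gamma>
  alone.\<close>

lemma Q_spaceI:
  assumes q: "homogeneous_polynomial k q" "reversible_equivariant G \<rho> \<sigma> q"
    and ker: "homological (blinfun_adjoint L) q = (\<lambda>x. 0)"
  shows "q \<in> Q_space k L G \<rho> \<sigma>"
proof -
  have "q (A (\<rho> \<gamma> x)) = of_int (\<sigma> \<gamma>) *\<^sub>R A (\<rho> \<gamma> (q x))"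
    if "A \<in> carrier (S_group L)" "\<gamma> \<in> carrier G" for A \<gamma> x
    using homological_kernel_S_group[OF homogeneous_imp_polynomial[OF q(1)] ker that(1)] q(2) that(2)
    by (simp add: reversible_equivariant_def blinfun.scaleR_right)
  with q(1) show ?thesis
    by (auto simp: Q_space_def reversible_equivariant_polys_def reversible_equivariant_def
        semidirect_product_def)
qed

section \<open>Compositions of near-identity changes of coordinates\<close>

lemma partial_composition_cong:
  "(\<And>i. 2 \<le> i \<Longrightarrow> i < m + 2 \<Longrightarrow> \<xi> i = \<zeta> i) \<Longrightarrow> partial_composition \<xi> m = partial_composition \<zeta> m"
proof (induction m)
  case (Suc m)
  have "partial_composition \<xi> m = partial_composition \<zeta> m"
    by (rule Suc.IH) (simp add: Suc.prems)
  with Suc.prems[of "m + 2"] show ?case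
    by simp
qed simp

lemma polynomial_partial_composition:
  fixes \<xi> :: "nat \<Rightarrow> 'a::euclidean_space \<Rightarrow> 'a"
  assumes "\<And>i. 2 \<le> i \<Longrightarrow> i < m + 2 \<Longrightarrow> homogeneous_polynomial i (\<xi> i)"
  shows "polynomial_function (partial_composition \<xi> m)"
  using assms
proof (induction m)
  case (Suc m)
  have "polynomial_function (partial_composition \<xi> m)"
    by (rule Suc.IH) (simp add: Suc.prems)
  moreover have "polynomial_function (\<lambda>y. y + \<xi> (m + 2) y)"
    using Suc.prems[of "m + 2"] by (intro polynomial_function_add polynomial_function_id homogeneous_imp_polynomial) auto
  ultimately show ?case
    by (simp only: partial_composition.simps polynomial_function_compose)
qed (simp add: id_def)

lemma partial_composition_commutes:
  fixes \<xi> :: "nat \<Rightarrow> 'a::real_normed_vector \<Rightarrow> 'a"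
  assumes "\<And>i x. 2 \<le> i \<Longrightarrow> i < m + 2 \<Longrightarrow> \<xi> i (blinfun_apply A x) = A (\<xi> i x)"
  shows "partial_composition \<xi> m (A x) = A (partial_composition \<xi> m x)"
  using assms
proof (induction m arbitrary: x)
  case (Suc m)
  have "partial_composition \<xi> m (A x) = A (partial_composition \<xi> m x)" for x
    by (rule Suc.IH) (simp add: Suc.prems)
  with Suc.prems[of "m + 2"] show ?case
    by (simp flip: blinfun.add_right)
qed simp

text \<open>The new innermost factor adds a term of degree m + 2, which to leading order passes
  through the linear part of the previous composition, the identity.\<close>

lemma taylor_part_partial_composition_Suc:
  fixes \<xi> :: "nat \<Rightarrow> 'a::euclidean_space \<Rightarrow> 'a"
  assumes "\<And>k. 2 \<le> k \<Longrightarrow> homogeneous_polynomial k (\<xi> k)"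
    and n: "n \<le> m + 2"
  shows "taylor_part n (partial_composition \<xi> (Suc m)) x =
      taylor_part n (partial_composition \<xi> m) x + (if n = m + 2 then \<xi> n x else 0)"
proof -
  have d: "taylor_part 1 f v = dderiv v f 0" for f :: "'a \<Rightarrow> 'a" and v
    by (simp add: taylor_part_dderiv)
  have step: "taylor_part n (partial_composition \<xi> (Suc m)) x = taylor_part n (partial_composition \<xi> m) x
      + (if n = m + 2 then dderiv (\<xi> n x) (partial_composition \<xi> m) 0 else 0)" if "n \<le> m + 2" for n m x
    using taylor_part_compose_add[OF polynomial_partial_composition polynomial_function_id refl assms(1), of m \<xi> "m + 2" n x]
      assms(1) that by (auto simp: o_def)
  \<comment> \<open>Every factor alters only degrees from 2 on; this is \<open>step\<close> read in
    degree 1.\<close>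
  have lin: "dderiv v (partial_composition \<xi> m) 0 = v" for v m
  proof (induction m)
    case 0
    show ?case
      by (simp add: id_def dderiv_linear[OF bounded_linear_ident])
  next
    case (Suc m)
    then show ?case
      using step[of 1 m v] by (simp only: d) simp
  qed
  show ?thesis
    using step[OF n] by (simp only: lin)
qed

text \<open>Each \<xi>_k is the defect in degree k between \<Phi> and the composition of the earlier
  factors. A linear map commuting with \<Phi> commutes with that composition and so with the
  defect.\<close>

lemma near_identity_infinite_composition:
  fixes \<Phi> :: "nat \<Rightarrow> 'a::euclidean_space \<Rightarrow> 'a"
  assumes \<Phi>: "\<Phi> 0 = (\<lambda>x. 0)" "\<Phi> 1 = (\<lambda>x. x)" "\<And>k. 2 \<le> k \<Longrightarrow> homogeneous_polynomial k (\<Phi> k)"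
  obtains \<xi> where "\<And>k. 2 \<le> k \<Longrightarrow> homogeneous_polynomial k (\<xi> k)" "infinite_composition \<xi> \<Phi>"
    "\<And>A k x. (\<And>j x. 2 \<le> j \<Longrightarrow> \<Phi> j (blinfun_apply A x) = A (\<Phi> j x)) \<Longrightarrow> 2 \<le> k \<Longrightarrow> \<xi> k (A x) = A (\<xi> k x)"
proof -
  \<comment> \<open>\<open>partial_composition \<xi> (k - 2)\<close> involves exactly \<xi>_2, ...,
    \<xi>_(k-1), so the recursion is well founded.\<close>
  have "\<exists>\<xi>. \<forall>k. \<xi> k = (\<lambda>x. \<Phi> k x - taylor_part k (partial_composition \<xi> (k - 2)) x)"
  proof (rule dependent_wellorder_choice)
    fix r and f g :: "nat \<Rightarrow> 'a \<Rightarrow> 'a" and k :: nat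
    assume "\<And>i. i < k \<Longrightarrow> f i = g i"
    then have "partial_composition f (k - 2) = partial_composition g (k - 2)"
      by (intro partial_composition_cong) auto
    then show "(r = (\<lambda>x. \<Phi> k x - taylor_part k (partial_composition f (k - 2)) x)) =
        (r = (\<lambda>x. \<Phi> k x - taylor_part k (partial_composition g (k - 2)) x))"
      by simp
  qed blast
  then obtain \<xi> where \<xi>: "\<And>k. \<xi> k = (\<lambda>x. \<Phi> k x - taylor_part k (partial_composition \<xi> (k - 2)) x)"
    by blast
  have hom: "homogeneous_polynomial k (\<xi> k)" if "2 \<le> k" for k
    using that
  proof (induction k rule: less_induct)
    case (less k)
    then have "polynomial_function (partial_composition \<xi> (k - 2))"
      by (intro polynomial_partial_composition) auto
    with less.prems show ?case
      by (subst \<xi>) (intro homogeneous_polynomial_diff homogeneous_polynomial_taylor_part polynomial_smooth \<Phi>)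
  qed
  \<comment> \<open>The first m factors end with \<xi>_(m+1), so all degrees up to m + 1 are
    final.\<close>
  have parts: "taylor_part n (partial_composition \<xi> m) = \<Phi> n" if "n - 1 \<le> m" for n m
    using that
  proof (induction m rule: dec_induct)
    case base
    show ?case
    proof (cases "2 \<le> n")
      case True
      then obtain l where n: "n = l + 2"
        by (metis add.commute le_Suc_ex)
      have "\<xi> n x = \<Phi> n x - taylor_part n (partial_composition \<xi> l) x" for x
        by (subst \<xi>) (simp add: n)
      then show ?thesis
        using taylor_part_partial_composition_Suc[OF hom, of n l]
        by (simp add: n fun_eq_iff del: partial_composition.simps)
    next
      case False
      have "homogeneous_polynomial 1 (\<lambda>x::'a. x)"
        by (simp add: homogeneous_polynomial_def)
      note taylor_part_homogeneous[OF this]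
      moreover have "n = 0 \<or> n = 1"
        using False by linarith
      ultimately show ?thesis
        using \<Phi>(1,2) by (elim disjE) (simp_all add: id_def fun_eq_iff)
    qed
  next
    case (step m)
    with taylor_part_partial_composition_Suc[OF hom, of n m] show ?case
      by (auto simp: fun_eq_iff simp del: partial_composition.simps)
  qed
  have "\<xi> k (A x) = A (\<xi> k x)"
    if A: "\<And>j x. 2 \<le> j \<Longrightarrow> \<Phi> j (blinfun_apply A x) = A (\<Phi> j x)" and k: "2 \<le> k" for A k x
    using k
  proof (induction k arbitrary: x rule: less_induct)
    case (less k)
    have "polynomial_function (partial_composition \<xi> (k - 2))"
      by (intro polynomial_partial_composition hom)
    moreover have "partial_composition \<xi> (k - 2) (A x) = A (partial_composition \<xi> (k - 2) x)" for x
      using less by (intro partial_composition_commutes) auto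
    ultimately have "taylor_part k (partial_composition \<xi> (k - 2)) (A x) = A (taylor_part k (partial_composition \<xi> (k - 2)) x)"
      by (intro taylor_part_intertwine polynomial_smooth)
    then show ?case
      by (subst (1 2) \<xi>) (simp add: A less.prems blinfun.diff_right)
  qed
  moreover have "infinite_composition \<xi> \<Phi>"
    unfolding infinite_composition_def eventually_sequentially using parts by (meson diff_le_self order_trans)
  ultimately show ?thesis
    using that hom by blast
qed

section \<open>Formal normal form\<close>

lemma reversible_equivariant_intertwine:
  assumes "reversible_equivariant G \<rho> \<sigma> f" "\<gamma> \<in> carrier G"
  shows "f (\<rho> \<gamma> x) = blinfun_apply (of_int (\<sigma> \<gamma>) *\<^sub>R \<rho> \<gamma>) (f x)"
  using assms by (simp add: reversible_equivariant_def blinfun.scaleR_left)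

text \<open>The highest part \<Phi>_n reaches degree n only through the linear term of F. Isolating
  it makes the equation solvable degree by degree.\<close>

lemma formal_compose_top:
  fixes F \<Phi> :: "nat \<Rightarrow> 'a::euclidean_space \<Rightarrow> 'a"
  assumes F: "\<And>i. homogeneous_polynomial i (F i)"
    and \<Phi>: "\<And>j. homogeneous_polynomial j (\<Phi> j)" "\<Phi> 0 0 = 0"
    and n: "1 \<le> n"
  shows "formal_compose F \<Phi> n x =
    taylor_part n (\<lambda>y. \<Sum>i\<le>n. F i (\<Sum>j<n. \<Phi> j y)) x + F 1 (\<Phi> n x)"
proof -
  let ?F = "\<lambda>z. \<Sum>i\<le>n. F i z" and ?p = "\<lambda>y. \<Sum>j<n. \<Phi> j y"
  note poly = homogeneous_imp_polynomial[OF F] homogeneous_imp_polynomial[OF \<Phi>(1)]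
  have "\<Phi> j 0 = 0" for j
    using \<Phi> homogeneous_polynomial_zero_at_0 by (cases j) auto
  then have "taylor_part n (\<lambda>y. ?F (?p y + \<Phi> n y)) x = taylor_part n (\<lambda>y. ?F (?p y)) x + (if n = n then dderiv (\<Phi> n x) ?F 0 else 0)"
    using n by (intro taylor_part_compose_add polynomial_function_sum poly \<Phi>(1)) auto
  moreover have "dderiv v ?F 0 = F 1 v" for v
  proof -
    have "taylor_part 1 ?F v = (\<Sum>i\<le>n. taylor_part 1 (F i) v)"
      using taylor_part_lincomb[of "{..n}" F 1 "\<lambda>i. 1"] poly by (simp add: polynomial_smooth)
    also have "\<dots> = F 1 v"
      using n by (simp add: taylor_part_homogeneous[OF F])
    finally show ?thesis
      by (simp add: taylor_part_dderiv)
  qed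
  moreover have "(\<lambda>y. \<Sum>i\<le>n. F i (\<Sum>j\<le>n. \<Phi> j y)) = (\<lambda>y. ?F (?p y + \<Phi> n y))"
    by (simp flip: lessThan_Suc_atMost[of n])
  ultimately show ?thesis
    by (simp add: formal_compose_def)
qed

text \<open>The index j = 1 gives Y_n because D\<Phi>_1 is the identity, j = n gives the transport
  of \<Phi>_n along Y_1, and j = n + 1 meets Y_0 = 0. In the remaining sum all indices of \<Phi> and
  Y lie strictly below n.\<close>

lemma formal_derivative_apply_split:
  fixes \<Phi> Y :: "nat \<Rightarrow> 'a::euclidean_space \<Rightarrow> 'a"
  assumes \<Phi>: "\<And>j. polynomial_function (\<Phi> j)" "\<Phi> 1 = (\<lambda>x. x)" and Y: "Y 0 = (\<lambda>x. 0)" and n: "2 \<le> n"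
  shows "formal_derivative_apply \<Phi> Y n x =
    Y n x + dderiv (Y 1 x) (\<Phi> n) x + (\<Sum>j = 2..<n. dderiv (Y (Suc n - j) x) (\<Phi> j) x)"
proof -
  have "{1..Suc n} = insert 1 (insert n (insert (Suc n) {2..<n}))"
    using n by auto
  moreover have "dderiv (Y (Suc n - Suc n) x) (\<Phi> (Suc n)) x = 0"
    by (simp add: Y dderiv_zero differentiable_at_polynomial_function \<Phi>(1))
  moreover have "dderiv (Y (Suc n - 1) x) (\<Phi> 1) x = Y n x"
    by (subst \<Phi>(2)) (simp add: dderiv_linear[OF bounded_linear_ident])
  ultimately show ?thesis
    using n by (simp add: formal_derivative_apply_def flip: dderiv_def)
qed

lemma homogeneous_polynomial_sum_dderiv:
  fixes \<Phi> Y :: "nat \<Rightarrow> 'a::euclidean_space \<Rightarrow> 'a"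
  assumes "\<And>j. j < n \<Longrightarrow> homogeneous_polynomial j (\<Phi> j)" "\<And>j. j < n \<Longrightarrow> homogeneous_polynomial j (Y j)"
  shows "homogeneous_polynomial n (\<lambda>x. \<Sum>j = 2..<n. dderiv (Y (Suc n - j) x) (\<Phi> j) x)"
proof -
  have "homogeneous_polynomial n (\<lambda>x. dderiv (Y (Suc n - j) x) (\<Phi> j) x)" if "j \<in> {2..<n}" for j
    using homogeneous_polynomial_dderiv_along[of "j - 1" "\<Phi> j" "Suc n - j" "Y (Suc n - j)"] assms that by auto
  with homogeneous_polynomial_lincomb[of "{2..<n}" n "\<lambda>j x. dderiv (Y (Suc n - j) x) (\<Phi> j) x" "\<lambda>_. 1"] show ?thesis
    by simp
qed

theorem theorem4p7:
  fixes G :: "('g, 'r) monoid_scheme"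
    and T :: "'g topology"
    and E :: "'m::euclidean_space set"
    and \<A> :: "('g set \<times> ('g \<Rightarrow> 'm)) set"
    and \<rho> :: "'g \<Rightarrow> 'a::euclidean_space \<Rightarrow>\<^sub>L 'a"
    and \<sigma> :: "'g \<Rightarrow> int"
    and X :: "'a \<Rightarrow> 'a"
    and L :: "'a \<Rightarrow>\<^sub>L 'a"
  assumes "compact_lie_group G T E \<A>"
    and "linear_action G T \<rho>"
    and "\<sigma> \<in> epi G sign_img"
    and "C_infinity_on UNIV X"
    and "reversible_equivariant G \<rho> \<sigma> X"
    and "X 0 = 0"
    and "(X has_derivative blinfun_apply L) (at 0)"
    and "\<And>s \<gamma>. \<gamma> \<in> carrier G \<Longrightarrow>
           blinfun_exp (s *\<^sub>R blinfun_adjoint L) o\<^sub>L \<rho> \<gamma> =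
           \<rho> \<gamma> o\<^sub>L blinfun_exp ((of_int (\<sigma> \<gamma>) * s) *\<^sub>R blinfun_adjoint L)"
  shows "\<exists>g. (\<forall>k\<ge>2. g k \<in> Q_space k L G \<rho> \<sigma>) \<and>
           formally_conjugate G \<rho> (\<lambda>k. taylor_part k X)
             (\<lambda>k. if k = 0 then (\<lambda>x. 0) else if k = 1 then blinfun_apply L else g k)"
proof -
  define M where "M = blinfun_adjoint L"
  have adj: "blinfun_apply L x \<bullet> y = x \<bullet> blinfun_apply M y" for x y
    unfolding M_def by (rule blinfun_adjoint_inner)
  have grp: "group G"
    using assms(1) by (simp add: compact_lie_group_def lie_group_def)
  have inv: "\<rho> \<gamma> (\<rho> (inv\<^bsub>G\<^esub> \<gamma>) x) = x" "\<rho> (inv\<^bsub>G\<^esub> \<gamma>) (\<rho> \<gamma> x) = x" if "\<gamma> \<in> carrier G" for \<gamma> x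
    using assms(2) that group.inv_closed[OF grp that] group.r_inv[OF grp that] group.l_inv[OF grp that]
    unfolding linear_action_def by (metis blinfun_apply_blinfun_compose blinfun_apply_id_blinfun id_apply)+
  have \<sigma>: "of_int (\<sigma> \<gamma>) * of_int (\<sigma> \<gamma>) = (1::real)" if "\<gamma> \<in> carrier G" for \<gamma>
  proof -
    have "\<sigma> \<gamma> \<in> {-1, 1}"
      using assms(3) that by (auto simp: epi_def sign_img_def hom_def Pi_def)
    then show ?thesis
      by auto
  qed

  have homX: "homogeneous_polynomial k (taylor_part k X)" for k
    using assms(4) by (rule homogeneous_polynomial_taylor_part)
  have revX: "reversible_equivariant G \<rho> \<sigma> (taylor_part k X)" for k
    using taylor_part_intertwine[OF assms(4) reversible_equivariant_intertwine[OF assms(5)]]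
    by (simp add: reversible_equivariant_def blinfun.scaleR_left)
  have X0: "taylor_part 0 X = (\<lambda>x. 0)"
    by (simp add: fun_eq_iff taylor_part_dderiv assms(6))
  have X1: "taylor_part 1 X = blinfun_apply L"
    using frechet_derivative_at[OF assms(7)] by (simp add: fun_eq_iff taylor_part_dderiv dderiv_def)
  have LA: "L (\<rho> \<gamma> x) = of_int (\<sigma> \<gamma>) *\<^sub>R \<rho> \<gamma> (L x)" if "\<gamma> \<in> carrier G" for \<gamma> x
    using revX[of 1] that unfolding X1 by (simp add: reversible_equivariant_def)
  have MA: "M (\<rho> \<gamma> x) = of_int (\<sigma> \<gamma>) *\<^sub>R \<rho> \<gamma> (M x)" if "\<gamma> \<in> carrier G" for \<gamma> x
    using assms(8)[OF that] unfolding M_def by (rule blinfun_exp_intertwine_generator)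

  define \<Phi> where "\<Phi> s j = (if j = 0 then (\<lambda>x. 0) else if j = 1 then (\<lambda>x. x) else fst (s j))"
    for s :: "nat \<Rightarrow> ('a \<Rightarrow> 'a) \<times> ('a \<Rightarrow> 'a)" and j
  define Y where "Y s j = (if j = 0 then (\<lambda>x. 0) else if j = 1 then blinfun_apply L else snd (s j))"
    for s :: "nat \<Rightarrow> ('a \<Rightarrow> 'a) \<times> ('a \<Rightarrow> 'a)" and j
  \<comment> \<open>The terms of degree n in the conjugacy equation that contain neither \<Phi>_n
    nor Y_n.\<close>
  define R where "R s n x = taylor_part n (\<lambda>y. \<Sum>i\<le>n. taylor_part i X (\<Sum>j<n. \<Phi> s j y)) x
      - (\<Sum>j = 2..<n. dderiv (Y s (Suc n - j) x) (\<Phi> s j) x)" for s n x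
  \<comment> \<open>The pair r consists of \<Phi>_n and g_n. The condition is void for n < 2, where
    \<open>\<Phi>\<close> and \<open>Y\<close> replace the chosen pair by 0, the identity and
    L.\<close>
  define P where "P s n r \<longleftrightarrow> (2 \<le> n \<longrightarrow>
      homogeneous_polynomial n (fst r) \<and> equivariant G \<rho> (fst r) \<and>
      homogeneous_polynomial n (snd r) \<and> reversible_equivariant G \<rho> \<sigma> (snd r) \<and>
      homological M (snd r) = (\<lambda>x. 0) \<and> R s n = (\<lambda>x. homological L (fst r) x + snd r x))" for s n r
  have \<Phi>P: "homogeneous_polynomial j (\<Phi> s j)" "equivariant G \<rho> (\<Phi> s j)"
    and YP: "homogeneous_polynomial j (Y s j)" "reversible_equivariant G \<rho> \<sigma> (Y s j)"
    if "P s j (s j)" for s j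
  proof -
    have "homogeneous_polynomial 0 (\<lambda>x::'a. 0::'a)" "homogeneous_polynomial 1 (\<lambda>x::'a. x)"
      "homogeneous_polynomial 1 (blinfun_apply L)"
      by (simp_all add: homogeneous_polynomial_def blinfun.scaleR_right polynomial_function_bounded_linear
          blinfun.bounded_linear_right)
    then show "homogeneous_polynomial j (\<Phi> s j)" "homogeneous_polynomial j (Y s j)"
      using that by (auto simp: \<Phi>_def Y_def P_def)
    show "equivariant G \<rho> (\<Phi> s j)" "reversible_equivariant G \<rho> \<sigma> (Y s j)"
      using that by (auto simp: \<Phi>_def Y_def P_def equivariant_def reversible_equivariant_def LA)
  qed

  \<comment> \<open>A choice by recursion on the degree: \<open>R s n\<close> looks at s only below
    n.\<close>
  have "\<exists>s. \<forall>n. P s n (s n)"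
  proof (rule dependent_wellorder_choice)
    fix r and s t :: "nat \<Rightarrow> ('a \<Rightarrow> 'a) \<times> ('a \<Rightarrow> 'a)" and n :: nat
    assume "\<And>i. i < n \<Longrightarrow> s i = t i"
    then have "\<Phi> s j = \<Phi> t j" "Y s j = Y t j" if "j < n" for j
      using that by (simp_all add: \<Phi>_def Y_def)
    then have "R s n x = R t n x" for x
      unfolding R_def by (intro arg_cong2[where f = "(-)"] sum.cong) auto
    then have "R s n = R t n" ..
    then show "P s n r = P t n r"
      by (simp add: P_def)
  next
    fix n and s :: "nat \<Rightarrow> ('a \<Rightarrow> 'a) \<times> ('a \<Rightarrow> 'a)"
    assume IH: "\<And>i. i < n \<Longrightarrow> P s i (s i)"
    define W where "W y = (\<Sum>i\<le>n. taylor_part i X (\<Sum>j<n. \<Phi> s j y))" for y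
    define D where "D x = (\<Sum>j = 2..<n. dderiv (Y s (Suc n - j) x) (\<Phi> s j) x)" for x
    have R: "R s n = (\<lambda>x. taylor_part n W x - D x)"
      by (simp add: R_def W_def[abs_def] D_def fun_eq_iff)
    have "polynomial_function (\<lambda>y. \<Sum>j<n. \<Phi> s j y)"
      using \<Phi>P(1)[OF IH] by (intro polynomial_function_sum homogeneous_imp_polynomial) auto
    from polynomial_function_compose[OF this homogeneous_imp_polynomial[OF homX]]
    have W: "C_infinity_on UNIV W"
      unfolding W_def[abs_def] by (intro polynomial_smooth polynomial_function_sum) (simp_all add: o_def)
    have "homogeneous_polynomial n D"
      unfolding D_def[abs_def] using \<Phi>P(1)[OF IH] YP(1)[OF IH] by (rule homogeneous_polynomial_sum_dderiv)
    then have homR: "homogeneous_polynomial n (R s n)"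
      unfolding R by (intro homogeneous_polynomial_diff homogeneous_polynomial_taylor_part W)
    \<comment> \<open>Parts of X composed with equivariant parts of \<Phi> keep the sign, and so
      does the equivariant derivative D\<Phi>_j applied to a reversible part of Y.\<close>
    have revR: "R s n (\<rho> \<gamma> x) = of_int (\<sigma> \<gamma>) *\<^sub>R \<rho> \<gamma> (R s n x)" if \<gamma>: "\<gamma> \<in> carrier G" for \<gamma> x
    proof -
      have \<Phi>A: "\<Phi> s j (\<rho> \<gamma> y) = \<rho> \<gamma> (\<Phi> s j y)" if "j < n" for j y
        using \<Phi>P(2)[OF IH[OF that]] \<gamma> by (simp add: equivariant_def)
      have YA: "Y s j (\<rho> \<gamma> y) = of_int (\<sigma> \<gamma>) *\<^sub>R \<rho> \<gamma> (Y s j y)" if "j < n" for j y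
        using YP(2)[OF IH[OF that]] \<gamma> by (simp add: reversible_equivariant_def)
      have "W (\<rho> \<gamma> y) = blinfun_apply (of_int (\<sigma> \<gamma>) *\<^sub>R \<rho> \<gamma>) (W y)" for y
      proof -
        have "(\<Sum>j<n. \<Phi> s j (\<rho> \<gamma> y)) = \<rho> \<gamma> (\<Sum>j<n. \<Phi> s j y)"
          by (simp add: \<Phi>A blinfun.sum_right)
        moreover have "taylor_part i X (\<rho> \<gamma> z) = of_int (\<sigma> \<gamma>) *\<^sub>R \<rho> \<gamma> (taylor_part i X z)" for i z
          using revX \<gamma> by (simp add: reversible_equivariant_def)
        ultimately show ?thesis
          by (simp add: W_def) (simp add: blinfun.scaleR_left blinfun.sum_right scaleR_sum_right)
      qed
      then have "taylor_part n W (\<rho> \<gamma> x) = of_int (\<sigma> \<gamma>) *\<^sub>R \<rho> \<gamma> (taylor_part n W x)"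
        using taylor_part_intertwine[OF W, of "\<rho> \<gamma>" "of_int (\<sigma> \<gamma>) *\<^sub>R \<rho> \<gamma>" n x]
        by (simp add: blinfun.scaleR_left)
      moreover have "dderiv (Y s (Suc n - j) (\<rho> \<gamma> x)) (\<Phi> s j) (\<rho> \<gamma> x) =
          of_int (\<sigma> \<gamma>) *\<^sub>R \<rho> \<gamma> (dderiv (Y s (Suc n - j) x) (\<Phi> s j) x)" if j: "j \<in> {2..<n}" for j
      proof -
        have d: "\<Phi> s j differentiable (at y)" for y
          using j \<Phi>P(1)[OF IH] by (intro differentiable_at_polynomial_function homogeneous_imp_polynomial) auto
        have "dderiv (\<rho> \<gamma> v) (\<Phi> s j) (\<rho> \<gamma> x) = \<rho> \<gamma> (dderiv v (\<Phi> s j) x)" for v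
          using j by (intro dderiv_intertwine d \<Phi>A) auto
        moreover have "Suc n - j < n"
          using j by auto
        ultimately show ?thesis
          by (simp add: YA linear_cmul[OF linear_dderiv[OF d]])
      qed
      then have "D (\<rho> \<gamma> x) = of_int (\<sigma> \<gamma>) *\<^sub>R \<rho> \<gamma> (D x)"
        by (simp add: D_def blinfun.sum_right scaleR_sum_right)
      ultimately show ?thesis
        by (simp add: R blinfun.diff_right scaleR_diff_right)
    qed
    obtain w q where wq: "homogeneous_polynomial n w" "homogeneous_polynomial n q"
      "homological M q = (\<lambda>x. 0)" "R s n = (\<lambda>x. homological L (homological M w) x + q x)"
      using homological_splitting[OF adj homR] by blast
    have "q (\<rho> \<gamma> x) = of_int (\<sigma> \<gamma>) *\<^sub>R \<rho> \<gamma> (q x)" "homological M w (\<rho> \<gamma> x) = \<rho> \<gamma> (homological M w x)"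
      if \<gamma>: "\<gamma> \<in> carrier G" for \<gamma> x
      using homological_splitting_symmetry[OF adj wq inv[OF \<gamma>] LA[OF \<gamma>] MA[OF \<gamma>] \<sigma>[OF \<gamma>] revR[OF \<gamma>]]
      by blast+
    \<comment> \<open>\<Phi>_n is \<open>homological M w\<close> and not w, because only the former
      is determined and so known to be equivariant.\<close>
    then have "P s n (homological M w, q)"
      using wq by (simp add: P_def equivariant_def reversible_equivariant_def homogeneous_polynomial_homological)
    then show "\<exists>r. P s n r" ..
  qed
  then obtain s where s: "\<And>n. P s n (s n)"
    by blast

  have \<Phi>1: "\<Phi> s 0 = (\<lambda>x. 0)" "\<Phi> s 1 = (\<lambda>x. x)"
    by (simp_all add: \<Phi>_def)
  obtain \<xi> where \<xi>: "\<And>k. 2 \<le> k \<Longrightarrow> homogeneous_polynomial k (\<xi> k)" "infinite_composition \<xi> (\<Phi> s)"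
    "\<And>A k x. (\<And>j x. 2 \<le> j \<Longrightarrow> \<Phi> s j (blinfun_apply A x) = A (\<Phi> s j x)) \<Longrightarrow> 2 \<le> k \<Longrightarrow> \<xi> k (A x) = A (\<xi> k x)"
    using near_identity_infinite_composition[OF \<Phi>1 \<Phi>P(1)[OF s]] by blast
  have eq\<xi>: "equivariant G \<rho> (\<xi> k)" if "2 \<le> k" for k
    using \<xi>(3)[OF _ that] \<Phi>P(2)[OF s] by (simp add: equivariant_def)

  have "formal_derivative_apply (\<Phi> s) (Y s) n x = formal_compose (\<lambda>k. taylor_part k X) (\<Phi> s) n x" for n x
  proof -
    have top: "formal_compose (\<lambda>k. taylor_part k X) (\<Phi> s) n x =
        taylor_part n (\<lambda>y. \<Sum>i\<le>n. taylor_part i X (\<Sum>j<n. \<Phi> s j y)) x + L (\<Phi> s n x)" if "1 \<le> n"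
      using formal_compose_top[OF homX \<Phi>P(1)[OF s] _ that] by (simp add: \<Phi>1 X1[simplified])
    have zero: "dderiv 0 (\<Phi> s j) x = 0" for j
      using \<Phi>P(1)[OF s] homogeneous_imp_polynomial differentiable_at_polynomial_function dderiv_zero by blast
    consider "n = 0" | "n = 1" | "2 \<le> n"
      by linarith
    then show ?thesis
    proof cases
      case 1
      then show ?thesis
        using zero[of 1] by (simp add: formal_derivative_apply_def formal_compose_def X0 Y_def taylor_part_dderiv
            flip: dderiv_def)
    next
      case 2
      have "formal_derivative_apply (\<Phi> s) (Y s) 1 x = L x"
        using zero[of 2] \<Phi>1(2) by (simp add: formal_derivative_apply_def Y_def numeral_2_eq_2
            dderiv_linear[OF bounded_linear_ident] flip: dderiv_def)
      \<comment> \<open>Below degree 1 only \<Phi>_0 = 0 enters, and X has no constant term, so the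
        right side in degree 1 is just L applied to \<Phi>_1.\<close>
      moreover have "(\<lambda>y. \<Sum>i\<le>1. taylor_part i X (\<Sum>j<1. \<Phi> s j y)) = (\<lambda>y. 0)"
        using X1 by (simp add: X0 \<Phi>1)
      ultimately show ?thesis
        using top 2 \<Phi>1(2) by (simp add: taylor_part_dderiv dderiv_def)
    next
      case 3
      have "\<Phi> s n = fst (s n)" "Y s n = snd (s n)" "Y s 1 = blinfun_apply L"
        using 3 by (simp_all add: \<Phi>_def Y_def)
      moreover have "R s n x = homological L (fst (s n)) x + snd (s n) x"
        using s[of n] 3 by (simp add: P_def)
      \<comment> \<open>Adding the isolated terms L \<Phi>_n and D\<Phi>_n L x to the splitting of
        \<open>R s n\<close> restores the full equation of degree n.\<close>
      ultimately show ?thesis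
        using 3 top formal_derivative_apply_split[where \<Phi> = "\<Phi> s" and Y = "Y s",
            OF homogeneous_imp_polynomial[OF \<Phi>P(1)[OF s]] \<Phi>1(2) _ 3, of x]
        by (simp add: R_def homological_def transport_def Y_def algebra_simps)
    qed
  qed
  then have "formally_conjugate G \<rho> (\<lambda>k. taylor_part k X) (Y s)"
    unfolding formally_conjugate_def using \<xi>(1,2) eq\<xi> by blast
  moreover have "snd (s k) \<in> Q_space k L G \<rho> \<sigma>" if "2 \<le> k" for k
    using s[of k] that by (intro Q_spaceI) (simp_all add: P_def M_def)
  ultimately show ?thesis
    unfolding Y_def[abs_def] by (intro exI[of _ "\<lambda>k. snd (s k)"]) blast
qed

end
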